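(* Let $\tau\in T_{\mathcal F}$ and $M\subset I_\tau$. Then $M$ is an $\mathcal H_{\mathcal F}$-submodule of $I_\tau$ if and only if $M$ is a ${}^{BL}\mathcal H_{\mathcal F}$-submodule of $I_\tau$. In particular, $I_\tau$ is irreducible as a ${}^{BL}\mathcal H_{\mathcal F}$-module if and only if $I_\tau$ is irreducible as an $\mathcal H_{\mathcal F}$-module.
   Context: Let $\mathcal S=(A,X,Y,(\alpha_i)_{i\in I},(\alpha_i^\vee)_{i\in I})$ be a root generating system: $A=(a_{i,j})$ is a Kac–Moody matrix (finite index set $I$, integer entries, $a_{i,i}=2$, $a_{i,j}\le 0$ for $i\ne j$, $a_{i,j}=0\iff a_{j,i}=0$), $X,Y$ are dual free $\mathbb Z$-modules of finite rank, $(\alpha_i)$ and $(\alpha_i^\vee)$ are free families in $X$ and $Y$ with $\alpha_j(\alpha_i^\vee)=a_{i,j}$. Put $\mathbb A=Y\otimes\mathbb R$, $r_i(v)=v-\alpha_i(v)\alpha_i^\vee$, $\mathscr S=\{r_i\}$, $W^v=\langle\mathscr S\rangle\subset GL(\mathbb A)$ (Coxeter group with length $\ell$); for $s=r_i$ write $\alpha_s=\alpha_i$, $\alpha_s^\vee=\alpha_i^\vee$. Let $C^v_f=\{v\in\mathbb A\mid\alpha_s(v)>0\ \forall s\in\mathscr S\}$, $\mathcal T=\bigcup_{w\in W^v}w.\overline{C^v_f}$ (Tits cone, a convex cone) and $Y^+=Y\cap\mathcal T$. $\mathcal F$ is a field of characteristic $0$ and $(\sigma_s)_{s\in\mathscr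 S},(\sigma'_s)_{s\in\mathscr S}$ are families in $\mathcal F^*$ such that $\sigma_s=\sigma'_s$ if $\alpha_s(Y)=\mathbb Z$, and $\sigma_s=\sigma_t=\sigma'_s=\sigma'_t$ for $s\ne t$ with $st$ of finite odd order. ${}^{BL}\mathcal H_{\mathcal F}$ is the $\mathcal F$-vector space with basis $(Z^\lambda H_w)_{\lambda\in Y,w\in W^v}$ ($Z^\lambda=Z^\lambda H_1$, $H_w=Z^0H_w$) with the unique associative product such that $Z^\lambda*H_w=Z^\lambda H_w$; $Z^\lambda*Z^\mu=Z^{\lambda+\mu}$; $H_s*H_w=H_{sw}$ if $\ell(sw)=\ell(w)+1$ and $H_s*H_w=(\sigma_s-\sigma_s^{-1})H_w+H_{sw}$ if $\ell(sw)=\ell(w)-1$; and $H_s*Z^\lambda-Z^{s.\lambda}*H_s=Q_s(Z)(Z^\lambda-Z^{s.\lambda})$ with $Q_s(Z)=\frac{(\sigma_s-\sigma_s^{-1})+(\sigma_s'-\sigma_s'^{-1})Z^{-\alpha_s^\vee}}{1-Z^{-2\alpha_s^\vee}}$. The Iwahori–Hecke algebra $\mathcal H_{\mathcal F}$ is the subalgebra spanned by $(Z^\lambda H_w)_{\lambda\in Y^+,w\in W^v}$. $T_{\mathcal F}=\mathrm{Hom}_{\mathrm{Gr}}(Y,\mathcal F^* )$; $\tau\in T_{\mathcal F}$ is extended to an algebra morphism $\mathcal F[Y]=\bigoplus_\lambda\mathcal FZ^\lambda\to\mathcal F$; $I_\tau={}^{BL}\mathcal H_{\mathcal F}\otimes_{\mathcal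 F[Y]}\mathcal F$, $\mathcal F[Y]$ acting on $\mathcal F$ via $\tau$. It is an $\mathcal H_{\mathcal F}$-module by restriction. *)

theory Defs
  imports "HOL-Analysis.Analysis" "HOL-Algebra.Free_Abelian_Groups"
    "HOL-Algebra.Generated_Groups" "HOL-Algebra.Multiplicative_Group"
begin

section \<open>Root generating systems\<close>

text \<open>
  The space \<open>Y \<otimes> \<real>\<close> is the whole type \<open>'v\<close>: a finite-dimensional real vector space in which \<open>Y\<close>
  is the set of integral combinations of a real basis. The norm carried by the type class only
  provides the (unique) vector space topology, needed for the closure of the fundamental chamber;
  unlike \<open>euclidean_space\<close>, the class allows rank 0.
  The dual module \<open>X = Hom (Y, \<int>)\<close> is the set of linear forms that are integral on \<open>Y\<close>.
\<close>

definition full_lattice :: "'v::real_normed_vector set \<Rightarrow> bool" where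
  "full_lattice Y \<longleftrightarrow> (\<exists>B. finite B \<and> independent B \<and> span B = UNIV \<and>
      Y = {\<Sum>b\<in>B. of_int (c b) *\<^sub>R b | c :: 'v \<Rightarrow> int. True})"

definition dual_lattice :: "'v::real_normed_vector set \<Rightarrow> ('v \<Rightarrow> real) set" where
  "dual_lattice Y = {f. linear f \<and> f ` Y \<subseteq> \<int>}"

definition kac_moody_matrix :: "'i set \<Rightarrow> ('i \<Rightarrow> 'i \<Rightarrow> int) \<Rightarrow> bool" where
  "kac_moody_matrix I a \<longleftrightarrow> finite I \<and>
     (\<forall>i\<in>I. a i i = 2) \<and>
     (\<forall>i\<in>I. \<forall>j\<in>I. i \<noteq> j \<longrightarrow> a i j \<le> 0) \<and>
     (\<forall>i\<in>I. \<forall>j\<in>I. a i j = 0 \<longleftrightarrow> a j i = 0)"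

definition GL :: "('v::real_vector \<Rightarrow> 'v) monoid" where
  "GL = \<lparr>carrier = {f. linear f \<and> bij f}, mult = (\<circ>), one = id\<rparr>"

locale root_generating_system =
  fixes I :: "'i set"
    and a :: "'i \<Rightarrow> 'i \<Rightarrow> int"
    and Y :: "'v::real_normed_vector set"
    and \<alpha> :: "'i \<Rightarrow> 'v \<Rightarrow> real"
    and \<alpha>v :: "'i \<Rightarrow> 'v"
  assumes matrix: "kac_moody_matrix I a"
    and lattice: "full_lattice Y"
    and root_in_X: "\<And>i. i \<in> I \<Longrightarrow> \<alpha> i \<in> dual_lattice Y"
    and coroot_in_Y: "\<And>i. i \<in> I \<Longrightarrow> \<alpha>v i \<in> Y"
    and roots_free: "\<And>c :: 'i \<Rightarrow> int.
          (\<forall>v. (\<Sum>i\<in>I. of_int (c i) * \<alpha> i v) = 0) \<Longrightarrow> \<forall>i\<in>I. c i = 0"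
    and coroots_free: "\<And>c :: 'i \<Rightarrow> int.
          (\<Sum>i\<in>I. of_int (c i) *\<^sub>R \<alpha>v i) = 0 \<Longrightarrow> \<forall>i\<in>I. c i = 0"
    and root_coroot: "\<And>i j. i \<in> I \<Longrightarrow> j \<in> I \<Longrightarrow> \<alpha> j (\<alpha>v i) = of_int (a i j)"
begin

definition r :: "'i \<Rightarrow> 'v \<Rightarrow> 'v" where
  "r i v = v - \<alpha> i v *\<^sub>R \<alpha>v i"

definition W :: "('v \<Rightarrow> 'v) set" where
  "W = generate GL (r ` I)"

definition len :: "('v \<Rightarrow> 'v) \<Rightarrow> nat" where
  "len w = (LEAST n. \<exists>ws. length ws = n \<and> set ws \<subseteq> r ` I \<and> w = foldr (\<circ>) ws id)"

definition fundamental_chamber :: "'v set" where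
  "fundamental_chamber = {v. \<forall>i\<in>I. \<alpha> i v > 0}"

definition tits_cone :: "'v set" where
  "tits_cone = (\<Union>w\<in>W. w ` closure fundamental_chamber)"

definition Y_plus :: "'v set" where
  "Y_plus = Y \<inter> tits_cone"

end


section \<open>Hecke algebras\<close>

definition scale :: "'f::field \<Rightarrow> ('b \<Rightarrow>\<^sub>0 'f) \<Rightarrow> ('b \<Rightarrow>\<^sub>0 'f)" where
  "scale c = Poly_Mapping.map ((*) c)"

text \<open>Since \<open>i \<mapsto> r i\<close> is injective on \<open>I\<close>, families indexed by simple reflections are indexed by \<open>I\<close>.
  The order of an element of infinite order is 0 in HOL-Algebra, hence not odd.\<close>

locale hecke_parameters = root_generating_system I a Y \<alpha> \<alpha>v
  for I :: "'i set" and a :: "'i \<Rightarrow> 'i \<Rightarrow> int" and Y :: "'v::real_normed_vector set"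
    and \<alpha> :: "'i \<Rightarrow> 'v \<Rightarrow> real" and \<alpha>v :: "'i \<Rightarrow> 'v" +
  fixes \<sigma> \<sigma>' :: "'i \<Rightarrow> 'f::field_char_0"
  assumes \<sigma>_nonzero: "\<And>i. i \<in> I \<Longrightarrow> \<sigma> i \<noteq> 0 \<and> \<sigma>' i \<noteq> 0"
    and \<sigma>_eq: "\<And>i. i \<in> I \<Longrightarrow> \<alpha> i ` Y = \<int> \<Longrightarrow> \<sigma> i = \<sigma>' i"
    and \<sigma>_odd: "\<And>i j. i \<in> I \<Longrightarrow> j \<in> I \<Longrightarrow> i \<noteq> j \<Longrightarrow> odd (group.ord GL (r i \<circ> r j)) \<Longrightarrow>
          \<sigma> i = \<sigma> j \<and> \<sigma> i = \<sigma>' i \<and> \<sigma> i = \<sigma>' j"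
begin

text \<open>The basis vector \<open>Z\<^sup>\<nu> H\<^sub>w\<close> of the Bernstein--Lusztig algebra is indexed by \<open>(\<nu>, w)\<close>.\<close>

definition BL_space :: "('v \<times> ('v \<Rightarrow> 'v) \<Rightarrow>\<^sub>0 'f) set" where
  "BL_space = {p. Poly_Mapping.keys p \<subseteq> Y \<times> W}"

definition ZH :: "'v \<Rightarrow> ('v \<Rightarrow> 'v) \<Rightarrow> 'v \<times> ('v \<Rightarrow> 'v) \<Rightarrow>\<^sub>0 'f" where
  "ZH \<nu> w = Poly_Mapping.single (\<nu>, w) 1"

abbreviation Z :: "'v \<Rightarrow> 'v \<times> ('v \<Rightarrow> 'v) \<Rightarrow>\<^sub>0 'f" where
  "Z \<nu> \<equiv> ZH \<nu> id"

abbreviation H :: "('v \<Rightarrow> 'v) \<Rightarrow> 'v \<times> ('v \<Rightarrow> 'v) \<Rightarrow>\<^sub>0 'f" where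
  "H w \<equiv> ZH 0 w"

definition FY :: "('v \<times> ('v \<Rightarrow> 'v) \<Rightarrow>\<^sub>0 'f) set" where
  "FY = {p. Poly_Mapping.keys p \<subseteq> Y \<times> {id}}"

definition H_space :: "('v \<times> ('v \<Rightarrow> 'v) \<Rightarrow>\<^sub>0 'f) set" where
  "H_space = {p. Poly_Mapping.keys p \<subseteq> Y_plus \<times> W}"

definition characters :: "('v \<Rightarrow> 'f) set" where
  "characters = {\<tau>. (\<forall>\<nu>\<in>Y. \<tau> \<nu> \<noteq> 0) \<and> (\<forall>\<nu>\<in>Y. \<forall>\<mu>\<in>Y. \<tau> (\<nu> + \<mu>) = \<tau> \<nu> * \<tau> \<mu>)}"

definition char_ext :: "('v \<Rightarrow> 'f) \<Rightarrow> ('v \<times> ('v \<Rightarrow> 'v) \<Rightarrow>\<^sub>0 'f) \<Rightarrow> 'f" where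
  "char_ext \<tau> p = (\<Sum>(\<nu>, w)\<in>Poly_Mapping.keys p. Poly_Mapping.lookup p (\<nu>, w) * \<tau> \<nu>)"

end

text \<open>
  The product of the Bernstein--Lusztig algebra is a parameter: it is the unique associative bilinear
  product on \<open>BL_space\<close> satisfying the relations below; its values outside are irrelevant.
  The last relation is \<open>H\<^sub>s * Z\<^sup>\<nu> - Z\<^sup>\<kappa> * H\<^sub>s = Q\<^sub>s(Z) (Z\<^sup>\<nu> - Z\<^sup>\<kappa>)\<close>, where \<open>\<kappa> = s.\<nu>\<close>, \<open>\<beta> = - \<alpha>\<^sub>s\<^sup>\<or>\<close> and
  \<open>Q\<^sub>s(Z) = ((\<sigma>\<^sub>s - 1/\<sigma>\<^sub>s) + (\<sigma>'\<^sub>s - 1/\<sigma>'\<^sub>s) Z\<^sup>\<beta>) / (1 - Z\<^sup>2\<^sup>\<beta>)\<close>. The right-hand side is the quotient in the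
  domain \<open>FY\<close>, i.e. the unique \<open>q\<close> in \<open>FY\<close> whose product with the denominator of \<open>Q\<^sub>s(Z)\<close> is the
  numerator times \<open>Z\<^sup>\<nu> - Z\<^sup>\<kappa>\<close>.
\<close>

locale BL_hecke_algebra = hecke_parameters I a Y \<alpha> \<alpha>v \<sigma> \<sigma>'
  for I :: "'i set" and a :: "'i \<Rightarrow> 'i \<Rightarrow> int" and Y :: "'v::real_normed_vector set"
    and \<alpha> :: "'i \<Rightarrow> 'v \<Rightarrow> real" and \<alpha>v :: "'i \<Rightarrow> 'v" and \<sigma> \<sigma>' :: "'i \<Rightarrow> 'f::field_char_0" +
  fixes prd :: "('v \<times> ('v \<Rightarrow> 'v) \<Rightarrow>\<^sub>0 'f) \<Rightarrow> ('v \<times> ('v \<Rightarrow> 'v) \<Rightarrow>\<^sub>0 'f) \<Rightarrow> ('v \<times> ('v \<Rightarrow> 'v) \<Rightarrow>\<^sub>0 'f)"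
      (infixl \<open>\<star>\<close> 70)
  assumes closed: "\<And>p q. p \<in> BL_space \<Longrightarrow> q \<in> BL_space \<Longrightarrow> p \<star> q \<in> BL_space"
    and add_left: "\<And>p q u. p \<in> BL_space \<Longrightarrow> q \<in> BL_space \<Longrightarrow> u \<in> BL_space \<Longrightarrow>
          (p + q) \<star> u = p \<star> u + q \<star> u"
    and add_right: "\<And>p q u. p \<in> BL_space \<Longrightarrow> q \<in> BL_space \<Longrightarrow> u \<in> BL_space \<Longrightarrow>
          u \<star> (p + q) = u \<star> p + u \<star> q"
    and scale_left: "\<And>c p q. p \<in> BL_space \<Longrightarrow> q \<in> BL_space \<Longrightarrow> scale c p \<star> q = scale c (p \<star> q)"
    and scale_right: "\<And>c p q. p \<in> BL_space \<Longrightarrow> q \<in> BL_space \<Longrightarrow> p \<star> scale c q = scale c (p \<star> q)"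
    and assoc: "\<And>p q u. p \<in> BL_space \<Longrightarrow> q \<in> BL_space \<Longrightarrow> u \<in> BL_space \<Longrightarrow>
          (p \<star> q) \<star> u = p \<star> (q \<star> u)"
    and Z_H: "\<And>\<nu> w. \<nu> \<in> Y \<Longrightarrow> w \<in> W \<Longrightarrow> Z \<nu> \<star> H w = ZH \<nu> w"
    and Z_Z: "\<And>\<nu> \<mu>. \<nu> \<in> Y \<Longrightarrow> \<mu> \<in> Y \<Longrightarrow> Z \<nu> \<star> Z \<mu> = Z (\<nu> + \<mu>)"
    and H_H_up: "\<And>i w. i \<in> I \<Longrightarrow> w \<in> W \<Longrightarrow> len (r i \<circ> w) = len w + 1 \<Longrightarrow>
          H (r i) \<star> H w = H (r i \<circ> w)"
    and H_H_down: "\<And>i w. i \<in> I \<Longrightarrow> w \<in> W \<Longrightarrow> len w = len (r i \<circ> w) + 1 \<Longrightarrow>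
          H (r i) \<star> H w = scale (\<sigma> i - inverse (\<sigma> i)) (H w) + H (r i \<circ> w)"
    and H_Z: "\<And>i \<nu>. i \<in> I \<Longrightarrow> \<nu> \<in> Y \<Longrightarrow>
          \<exists>q\<in>FY. H (r i) \<star> Z \<nu> - Z (r i \<nu>) \<star> H (r i) = q \<and>
            (Z 0 - Z (- (2 *\<^sub>R \<alpha>v i))) \<star> q =
            (scale (\<sigma> i - inverse (\<sigma> i)) (Z 0) + scale (\<sigma>' i - inverse (\<sigma>' i)) (Z (- \<alpha>v i)))
              \<star> (Z \<nu> - Z (r i \<nu>))"


section \<open>Tensor products and principal series\<close>

text \<open>\<open>M \<otimes>\<^sub>R N\<close> for a right module \<open>M\<close> (action \<open>ract\<close>) and a left module \<open>N\<close> (action \<open>lact\<close>): the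
  free abelian group on \<open>M \<times> N\<close> modulo the subgroup generated by the usual relations.\<close>

definition tensor_relations ::
    "'m::ab_group_add set \<Rightarrow> 'n::ab_group_add set \<Rightarrow> 'r set \<Rightarrow> ('m \<Rightarrow> 'r \<Rightarrow> 'm) \<Rightarrow> ('r \<Rightarrow> 'n \<Rightarrow> 'n) \<Rightarrow>
     ('m \<times> 'n \<Rightarrow>\<^sub>0 int) set" where
  "tensor_relations M N R ract lact =
     {frag_of (m + m', n) - frag_of (m, n) - frag_of (m', n) | m m' n. m \<in> M \<and> m' \<in> M \<and> n \<in> N} \<union>
     {frag_of (m, n + n') - frag_of (m, n) - frag_of (m, n') | m n n'. m \<in> M \<and> n \<in> N \<and> n' \<in> N} \<union>
     {frag_of (ract m x, n) - frag_of (m, lact x n) | m x n. m \<in> M \<and> x \<in> R \<and> n \<in> N}"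

definition tensor_kernel ::
    "'m::ab_group_add set \<Rightarrow> 'n::ab_group_add set \<Rightarrow> 'r set \<Rightarrow> ('m \<Rightarrow> 'r \<Rightarrow> 'm) \<Rightarrow> ('r \<Rightarrow> 'n \<Rightarrow> 'n) \<Rightarrow>
     ('m \<times> 'n \<Rightarrow>\<^sub>0 int) set" where
  "tensor_kernel M N R ract lact =
     generate (free_Abelian_group (M \<times> N)) (tensor_relations M N R ract lact)"

definition tensor_product ::
    "'m::ab_group_add set \<Rightarrow> 'n::ab_group_add set \<Rightarrow> 'r set \<Rightarrow> ('m \<Rightarrow> 'r \<Rightarrow> 'm) \<Rightarrow> ('r \<Rightarrow> 'n \<Rightarrow> 'n) \<Rightarrow>
     ('m \<times> 'n \<Rightarrow>\<^sub>0 int) set monoid" where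
  "tensor_product M N R ract lact =
     free_Abelian_group (M \<times> N) Mod tensor_kernel M N R ract lact"

text \<open>The class of \<open>\<Sum> k\<^sub>j (m\<^sub>j, n\<^sub>j)\<close> is sent to the class of \<open>\<Sum> k\<^sub>j (f m\<^sub>j, n\<^sub>j)\<close>; the cosets in the union
  coincide when \<open>f\<close> is an endomorphism of the right module \<open>M\<close>.\<close>

definition tensor_map_left ::
    "'m::ab_group_add set \<Rightarrow> 'n::ab_group_add set \<Rightarrow> 'r set \<Rightarrow> ('m \<Rightarrow> 'r \<Rightarrow> 'm) \<Rightarrow> ('r \<Rightarrow> 'n \<Rightarrow> 'n) \<Rightarrow>
     ('m \<Rightarrow> 'm) \<Rightarrow> ('m \<times> 'n \<Rightarrow>\<^sub>0 int) set \<Rightarrow> ('m \<times> 'n \<Rightarrow>\<^sub>0 int) set" where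
  "tensor_map_left M N R ract lact f C =
     (\<Union>x\<in>C. tensor_kernel M N R ract lact #>\<^bsub>free_Abelian_group (M \<times> N)\<^esub>
        frag_extend (\<lambda>(m, n). frag_of (f m, n)) x)"

text \<open>An abelian group \<open>G\<close> (written as a HOL-Algebra group) on which the elements of \<open>R\<close> act through
  \<open>act\<close>. A unital \<open>F\<close>-algebra \<open>R\<close> contains the scalars, so its submodules are \<open>F\<close>-subspaces.\<close>

definition is_submodule :: "('g, 'c) monoid_scheme \<Rightarrow> 'r set \<Rightarrow> ('r \<Rightarrow> 'g \<Rightarrow> 'g) \<Rightarrow> 'g set \<Rightarrow> bool" where
  "is_submodule G R act M \<longleftrightarrow> subgroup M G \<and> (\<forall>x\<in>R. \<forall>u\<in>M. act x u \<in> M)"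

definition is_irreducible :: "('g, 'c) monoid_scheme \<Rightarrow> 'r set \<Rightarrow> ('r \<Rightarrow> 'g \<Rightarrow> 'g) \<Rightarrow> bool" where
  "is_irreducible G R act \<longleftrightarrow> carrier G \<noteq> {\<one>\<^bsub>G\<^esub>} \<and>
     (\<forall>M. is_submodule G R act M \<longrightarrow> M = {\<one>\<^bsub>G\<^esub>} \<or> M = carrier G)"

context BL_hecke_algebra
begin

definition I_rep ::
    "('v \<Rightarrow> 'f) \<Rightarrow> (('v \<times> ('v \<Rightarrow> 'v) \<Rightarrow>\<^sub>0 'f) \<times> 'f \<Rightarrow>\<^sub>0 int) set monoid" where
  "I_rep \<tau> = tensor_product BL_space UNIV FY (\<star>) (\<lambda>p c. char_ext \<tau> p * c)"

definition I_act ::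
    "('v \<Rightarrow> 'f) \<Rightarrow> ('v \<times> ('v \<Rightarrow> 'v) \<Rightarrow>\<^sub>0 'f) \<Rightarrow>
     (('v \<times> ('v \<Rightarrow> 'v) \<Rightarrow>\<^sub>0 'f) \<times> 'f \<Rightarrow>\<^sub>0 int) set \<Rightarrow> (('v \<times> ('v \<Rightarrow> 'v) \<Rightarrow>\<^sub>0 'f) \<times> 'f \<Rightarrow>\<^sub>0 int) set" where
  "I_act \<tau> h = tensor_map_left BL_space UNIV FY (\<star>) (\<lambda>p c. char_ext \<tau> p * c) (\<lambda>p. h \<star> p)"

end

end

theory Submission
  imports Defs
begin

text \<open>
  An \<open>\<H>\<close>-submodule \<open>M\<close> of \<open>I\<^sub>\<tau>\<close> is stable under \<open>Z\<^sup>\<mu>\<close> for \<open>\<mu> \<in> Y\<^sup>+\<close>. Every vector of \<open>I\<^sub>\<tau>\<close> is killed by a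
  product of factors \<open>Z\<^sup>\<mu> - c\<close> with \<open>c \<noteq> 0\<close>: this holds for \<open>1 \<otimes> 1\<close>, and the Bernstein--Lusztig relation
  transports it from \<open>H\<^sub>w \<otimes> 1\<close> to \<open>H\<^sub>s\<^sub>w \<otimes> 1\<close>. Hence \<open>M\<close> is also stable under the inverse \<open>Z\<^sup>-\<^sup>\<mu>\<close>. Since there is a
  regular dominant coweight, any \<open>h\<close> in the Bernstein--Lusztig algebra satisfies \<open>Z\<^sup>\<mu> h \<in> \<H>\<close> for some
  \<open>\<mu> \<in> Y\<^sup>+\<close>, and \<open>h u = Z\<^sup>-\<^sup>\<mu> (Z\<^sup>\<mu> h u)\<close>.
\<close>

section \<open>Weyl group words and dominant coweights\<close>

context root_generating_system
begin

section \<open>Arithmetic of the lattice \<open>Y\<close> and the simple reflections\<close>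

lemma finite_I: "finite I"
  using matrix by (simp add: kac_moody_matrix_def)

lemma linear_root: "i \<in> I \<Longrightarrow> linear (\<alpha> i)"
  using root_in_X by (simp add: dual_lattice_def)

lemma root_int: "i \<in> I \<Longrightarrow> \<nu> \<in> Y \<Longrightarrow> \<alpha> i \<nu> \<in> \<int>"
  using root_in_X by (fastforce simp: dual_lattice_def)

lemma Y_zero: "0 \<in> Y"
proof -
  obtain B where "Y = {\<Sum>b\<in>B. of_int (c b) *\<^sub>R b | c :: 'v \<Rightarrow> int. True}"
    using lattice unfolding full_lattice_def by blast
  then show ?thesis
    by (auto intro!: exI[of _ "\<lambda>_. 0"])
qed

lemma Y_add: "\<nu> \<in> Y \<Longrightarrow> \<mu> \<in> Y \<Longrightarrow> \<nu> + \<mu> \<in> Y"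
proof -
  obtain B where B: "Y = {\<Sum>b\<in>B. of_int (c b) *\<^sub>R b | c :: 'v \<Rightarrow> int. True}"
    using lattice unfolding full_lattice_def by blast
  assume "\<nu> \<in> Y" "\<mu> \<in> Y"
  then obtain c d :: "'v \<Rightarrow> int" where "\<nu> = (\<Sum>b\<in>B. of_int (c b) *\<^sub>R b)" "\<mu> = (\<Sum>b\<in>B. of_int (d b) *\<^sub>R b)"
    unfolding B by blast
  then have "\<nu> + \<mu> = (\<Sum>b\<in>B. of_int (c b + d b) *\<^sub>R b)"
    by (simp add: scaleR_add_left sum.distrib)
  then show ?thesis
    unfolding B mem_Collect_eq by (intro exI[of _ "\<lambda>b. c b + d b"]) simp
qed

lemma Y_scale: "\<nu> \<in> Y \<Longrightarrow> of_int n *\<^sub>R \<nu> \<in> Y"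
proof -
  obtain B where B: "Y = {\<Sum>b\<in>B. of_int (c b) *\<^sub>R b | c :: 'v \<Rightarrow> int. True}"
    using lattice unfolding full_lattice_def by blast
  assume "\<nu> \<in> Y"
  then obtain c :: "'v \<Rightarrow> int" where "\<nu> = (\<Sum>b\<in>B. of_int (c b) *\<^sub>R b)"
    unfolding B by blast
  then have "of_int n *\<^sub>R \<nu> = (\<Sum>b\<in>B. of_int (n * c b) *\<^sub>R b)"
    by (simp add: scaleR_sum_right)
  then show ?thesis
    unfolding B mem_Collect_eq by (intro exI[of _ "\<lambda>b. n * c b"]) simp
qed

lemma Y_minus: "\<nu> \<in> Y \<Longrightarrow> - \<nu> \<in> Y"
  using Y_scale[of \<nu> "-1"] by simp

lemma Y_diff: "\<nu> \<in> Y \<Longrightarrow> \<mu> \<in> Y \<Longrightarrow> \<nu> - \<mu> \<in> Y"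
  using Y_add[of \<nu> "- \<mu>"] Y_minus by simp

lemma Y_sum: "(\<And>x. x \<in> A \<Longrightarrow> f x \<in> Y) \<Longrightarrow> sum f A \<in> Y"
  by (induction A rule: infinite_finite_induct) (auto intro: Y_zero Y_add)

text \<open>\<open>Y\<close> contains the real basis that defines it. Consequently a nonzero linear
  form is nonzero at some lattice point.\<close>

lemma span_Y: "span Y = UNIV"
proof -
  obtain B where B: "finite B" "span B = UNIV"
      "Y = {\<Sum>b\<in>B. of_int (c b) *\<^sub>R b | c :: 'v \<Rightarrow> int. True}"
    using lattice unfolding full_lattice_def by blast
  have "b \<in> Y" if "b \<in> B" for b
  proof -
    have "b = (\<Sum>x\<in>B. of_int (if x = b then 1 else 0) *\<^sub>R x)"
      using B(1) that by (simp add: if_distrib[of "\<lambda>c. of_int c *\<^sub>R _"] cong: if_cong)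
    then show ?thesis
      unfolding B(3) mem_Collect_eq by (intro exI[of _ "\<lambda>x. if x = b then 1 else 0"]) simp
  qed
  then show ?thesis
    using B(2) span_mono[of B Y] by auto
qed

lemma r_Y: "i \<in> I \<Longrightarrow> \<nu> \<in> Y \<Longrightarrow> r i \<nu> \<in> Y"
  using Y_diff Y_scale coroot_in_Y root_int by (metis Ints_cases r_def)

lemma r_r: "i \<in> I \<Longrightarrow> r i (r i v) = v"
proof -
  assume i: "i \<in> I"
  then have "\<alpha> i (\<alpha>v i) = 2"
    using root_coroot[OF i i] matrix by (simp add: kac_moody_matrix_def)
  then show ?thesis
    by (simp add: r_def linear_diff[OF linear_root[OF i]] linear_scale[OF linear_root[OF i]] algebra_simps)
qed

lemma r_carrier: "i \<in> I \<Longrightarrow> r i \<in> carrier GL"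
proof -
  assume i: "i \<in> I"
  interpret linear "\<alpha> i" by (rule linear_root[OF i])
  have "linear (r i)"
    by (rule linearI) (simp_all add: r_def add scale algebra_simps)
  moreover have "bij (r i)"
    using r_r[OF i] by (intro o_bij[of "r i"]) auto
  ultimately show ?thesis
    by (simp add: GL_def)
qed

end

lemma group_GL: "group GL"
proof (rule groupI)
  fix f :: "'v::real_vector \<Rightarrow> 'v"
  assume "f \<in> carrier GL"
  then have f: "linear f" "bij f" by (auto simp: GL_def)
  let ?g = "inv_into UNIV f"
  have fg: "f (?g x) = x" for x
    using f(2) by (simp add: bij_def surj_f_inv_f)
  have eq: "?g y = x" if "f x = y" for x y
    using f(2) that by (simp add: bij_def inv_f_eq)
  have "linear ?g"
    by (rule linearI) (auto intro!: eq simp: linear_add[OF f(1)] linear_scale[OF f(1)] fg)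
  moreover have "?g \<circ> f = id" using eq by fastforce
  ultimately show "\<exists>g\<in>carrier GL. g \<otimes>\<^bsub>GL\<^esub> f = \<one>\<^bsub>GL\<^esub>"
    using f by (intro bexI[of _ ?g]) (auto simp: GL_def bij_imp_bij_inv)
next
  show "\<one>\<^bsub>GL\<^esub> \<in> carrier (GL :: ('v::real_vector \<Rightarrow> 'v) monoid)"
    by (simp add: GL_def linear_id)
qed (simp_all add: GL_def linear_compose bij_comp o_assoc)

context root_generating_system
begin

section \<open>Words in the simple reflections and induction on the length\<close>

lemma id_W: "id \<in> W"
  using generate.one[of GL "r ` I"] by (simp add: W_def GL_def)

lemma r_comp_W: "i \<in> I \<Longrightarrow> w \<in> W \<Longrightarrow> r i \<circ> w \<in> W"
  using generate.eng[OF generate.incl[of "r i" "r ` I" GL], of w] by (simp add: W_def GL_def)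

lemma r_W: "i \<in> I \<Longrightarrow> r i \<in> W"
  unfolding W_def by (rule generate.incl) simp

text \<open>\<open>generate\<close> also adjoins inverses, but each simple reflection is its own
  inverse, so plain words suffice and group products become concatenations.\<close>

lemma W_word:
  assumes "w \<in> W"
  obtains ws where "set ws \<subseteq> r ` I" "w = foldr (\<circ>) ws id"
proof -
  interpret GL: group GL by (rule group_GL)
  have "w \<in> generate GL (r ` I)" using assms by (simp add: W_def)
  then have "\<exists>ws. set ws \<subseteq> r ` I \<and> w = foldr (\<circ>) ws id"
  proof (induction rule: generate.induct)
    case one
    show ?case by (intro exI[of _ "[]"]) (simp add: GL_def)
  next
    case (incl h)
    then show ?case by (intro exI[of _ "[h]"]) simp
  next
    case (inv h)
    then obtain i where i: "i \<in> I" "h = r i" by auto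
    then have "inv\<^bsub>GL\<^esub> h = h"
      using r_r[OF i(1)] r_carrier[OF i(1)] by (intro GL.inv_equality) (auto simp: GL_def)
    then show ?case using inv by (intro exI[of _ "[h]"]) simp
  next
    case (eng h1 h2)
    then obtain us vs where "set us \<subseteq> r ` I" "h1 = foldr (\<circ>) us id"
      "set vs \<subseteq> r ` I" "h2 = foldr (\<circ>) vs id" by blast
    moreover have "foldr (\<circ>) us id \<circ> foldr (\<circ>) vs id = foldr (\<circ>) (us @ vs) id"
      by (induction us) (simp_all add: o_assoc[symmetric] fun_eq_iff)
    ultimately have "set (us @ vs) \<subseteq> r ` I" "h1 \<otimes>\<^bsub>GL\<^esub> h2 = foldr (\<circ>) (us @ vs) id"
      by (auto simp only: GL_def monoid.simps set_append)
    then show ?case by blast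
  qed
  then show thesis using that by blast
qed

lemma foldr_W: "set ws \<subseteq> r ` I \<Longrightarrow> foldr (\<circ>) ws id \<in> W"
  by (induction ws) (auto simp: id_W r_comp_W)

lemma len_foldr: "set ws \<subseteq> r ` I \<Longrightarrow> len (foldr (\<circ>) ws id) \<le> length ws"
  unfolding len_def by (rule Least_le) blast

lemma W_reduced_word:
  assumes "w \<in> W"
  obtains ws where "set ws \<subseteq> r ` I" "w = foldr (\<circ>) ws id" "length ws = len w"
proof -
  obtain us where "set us \<subseteq> r ` I" "w = foldr (\<circ>) us id"
    using W_word[OF assms] .
  then have "\<exists>n ws. length ws = n \<and> set ws \<subseteq> r ` I \<and> w = foldr (\<circ>) ws id" by blast
  then have "\<exists>ws. length ws = len w \<and> set ws \<subseteq> r ` I \<and> w = foldr (\<circ>) ws id"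
    unfolding len_def by (rule LeastI_ex)
  then show thesis using that by blast
qed

text \<open>Strip the first letter of a reduced word. The tail is reduced too, since a shorter word
  for it would shorten the whole word, so the length rises by exactly one at each step. This is the
  situation in which \<open>H_H_up\<close> applies.\<close>

lemma W_length_induct [consumes 1, case_names id step]:
  assumes "w \<in> W" and "P id"
    and step: "\<And>i w. i \<in> I \<Longrightarrow> w \<in> W \<Longrightarrow> len (r i \<circ> w) = len w + 1 \<Longrightarrow> P w \<Longrightarrow> P (r i \<circ> w)"
  shows "P w"
  using assms(1)
proof (induction "len w" arbitrary: w rule: less_induct)
  case less
  obtain ws where ws: "set ws \<subseteq> r ` I" "w = foldr (\<circ>) ws id" "length ws = len w"
    using W_reduced_word[OF less.prems] .
  show ?case
  proof (cases ws)
    case Nil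
    then show ?thesis using ws \<open>P id\<close> by simp
  next
    case (Cons s us)
    define v where "v = foldr (\<circ>) us id"
    obtain i where i: "i \<in> I" "s = r i" using ws Cons by auto
    have v: "v \<in> W" "len v \<le> length us" "w = r i \<circ> v"
      using ws Cons i by (auto simp: v_def foldr_W len_foldr)
    obtain vs where vs: "set vs \<subseteq> r ` I" "v = foldr (\<circ>) vs id" "length vs = len v"
      using W_reduced_word[OF v(1)] .
    have "len w \<le> length (r i # vs)"
      using len_foldr[of "r i # vs"] vs i v by auto
    then have "len w = len v + 1"
      using ws(3) Cons v(2) vs(3) by simp
    then show ?thesis
      using step[OF i(1) v(1)] less.hyps[of v] v by simp
  qed
qed

section \<open>Regular dominant coweights and translation into the Tits cone\<close>

text \<open>Freeness of the roots is stated with integer coefficients, and the dual vectors must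
  stay in \<open>Y\<close>. So the dual family is built by elimination without division, at the cost
  of a common nonzero factor \<open>N\<close>, which changes in each induction step and may be
  negative.\<close>

lemma dual_family:
  assumes "finite J" "J \<subseteq> I"
  shows "\<exists>N::int. N \<noteq> 0 \<and> (\<exists>l. \<forall>j\<in>J. l j \<in> Y \<and>
    (\<forall>k\<in>J. \<alpha> k (l j) = (if k = j then of_int N else 0)))"
  using assms
proof (induction J rule: finite_induct)
  case empty
  show ?case by (intro exI[of _ 1]) simp
next
  case (insert k J)
  then obtain N :: int and l where N: "N \<noteq> 0" and dual: "\<forall>j\<in>J. l j \<in> Y \<and>
      (\<forall>k\<in>J. \<alpha> k (l j) = (if k = j then of_int N else 0))"
    by (metis insert_subset)
  have lY: "l j \<in> Y" if "j \<in> J" for j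
    using dual that by blast
  have l: "\<alpha> i (l j) = (if i = j then of_int N else 0)" if "j \<in> J" "i \<in> J" for i j
    using dual that by blast
  have k: "k \<in> I" and JI: "J \<subseteq> I" using insert.prems by auto
  have "\<exists>m. \<alpha> k (l j) = of_int m" if "j \<in> J" for j
    using root_int[OF k lY[OF that]] by (auto elim: Ints_cases)
  then obtain c :: "'i \<Rightarrow> int" where c: "\<And>j. j \<in> J \<Longrightarrow> \<alpha> k (l j) = of_int (c j)"
    by metis
  \<comment> \<open>\<open>\<beta>\<close> is \<open>N\<close> times the new root, corrected so as
    to vanish on every \<open>l j\<close> with \<open>j\<close> in \<open>J\<close>.\<close>
  define \<beta> where "\<beta> v = of_int N * \<alpha> k v - (\<Sum>j\<in>J. of_int (c j) * \<alpha> j v)" for v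
  have lin: "linear \<beta>"
    unfolding \<beta>_def real_scaleR_def[symmetric]
    using JI by (intro linear_compose_sub linear_compose_sum linear_compose_scale_right linear_root k ballI) auto
  have "\<exists>v. \<beta> v \<noteq> 0"
  proof (rule ccontr)
    assume no: "\<nexists>v. \<beta> v \<noteq> 0"
    \<comment> \<open>\<open>d\<close> lists the coefficients of \<open>\<beta>\<close>. If
      \<open>\<beta>\<close> were zero, this would be an integer relation between the roots whose
      coefficient at \<open>k\<close> is \<open>N\<close>, which is nonzero.\<close>
    define d where "d i = (if i = k then N else if i \<in> J then - c i else 0)" for i
    have "(\<Sum>i\<in>I. of_int (d i) * \<alpha> i v) = \<beta> v" for v
    proof -
      have "(\<Sum>i\<in>I. of_int (d i) * \<alpha> i v) = (\<Sum>i\<in>insert k J. of_int (d i) * \<alpha> i v)"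
        using finite_I insert.prems by (intro sum.mono_neutral_right) (auto simp: d_def)
      also have "\<dots> = of_int N * \<alpha> k v + (\<Sum>i\<in>J. of_int (d i) * \<alpha> i v)"
        using insert.hyps by (simp add: d_def)
      also have "(\<Sum>i\<in>J. of_int (d i) * \<alpha> i v) = (\<Sum>i\<in>J. - (of_int (c i) * \<alpha> i v))"
        using insert.hyps by (intro sum.cong) (auto simp: d_def)
      finally show ?thesis by (simp add: \<beta>_def sum_negf)
    qed
    then have "d k = 0" using no roots_free[of d] k by auto
    then show False using N by (simp add: d_def)
  qed
  moreover have "\<beta> v = 0" if "\<And>y. y \<in> Y \<Longrightarrow> \<beta> y = 0" for v
    using linear_eq_0_on_span[OF lin that] span_Y by auto
  ultimately obtain v where v: "v \<in> Y" "\<beta> v \<noteq> 0" by blast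
  have "\<exists>m. \<alpha> j v = of_int m" if "j \<in> insert k J" for j
    using root_int[OF _ v(1), of j] insert.prems that by (auto elim: Ints_cases)
  then obtain b :: "'i \<Rightarrow> int" where b: "\<And>j. j \<in> insert k J \<Longrightarrow> \<alpha> j v = of_int (b j)"
    by metis
  define M where "M = N * b k - (\<Sum>j\<in>J. c j * b j)"
  \<comment> \<open>The components of \<open>N v\<close> along the \<open>l j\<close> are removed:
    the roots in \<open>J\<close> vanish on \<open>lk\<close>, while \<open>\<alpha> k\<close> takes
    the value \<open>\<beta> v\<close>, that is \<open>M\<close>, on it.\<close>
  define lk where "lk = of_int N *\<^sub>R v - (\<Sum>j\<in>J. of_int (b j) *\<^sub>R l j)"
  have M: "\<beta> v = of_int M"
    using b by (simp add: \<beta>_def M_def)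
  have lkY: "lk \<in> Y"
    unfolding lk_def by (intro Y_diff Y_scale Y_sum v lY)
  have val: "\<alpha> i lk = of_int N * \<alpha> i v - (\<Sum>j\<in>J. of_int (b j) * \<alpha> i (l j))" if "i \<in> I" for i
    using linear_root[OF that]
    by (simp add: lk_def linear_diff linear_sum linear_scale)
  have lk_k: "\<alpha> k lk = of_int M"
    unfolding val[OF k] M[symmetric] \<beta>_def using b c by (simp add: mult.commute cong: sum.cong)
  have lk_J: "\<alpha> i lk = 0" if "i \<in> J" for i
  proof -
    have "(\<Sum>j\<in>J. of_int (b j) * \<alpha> i (l j)) = (\<Sum>j\<in>J. if j = i then of_int (b i) * of_int N else 0)"
      using l that by (intro sum.cong) auto
    then show ?thesis
      using val[of i] that JI insert.hyps(1) b[of i] by auto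
  qed
  \<comment> \<open>Subtracting \<open>c j\<close> times \<open>lk\<close> cancels the value of
    \<open>\<alpha> k\<close> on \<open>M\<close> times \<open>l j\<close>. The factor
    \<open>N\<close> in front of \<open>lk\<close> makes all diagonal values equal to
    \<open>N * M\<close>.\<close>
  define l' where "l' j = (if j = k then of_int N *\<^sub>R lk else of_int M *\<^sub>R l j - of_int (c j) *\<^sub>R lk)" for j
  have "\<alpha> i (l' j) = (if i = j then of_int (N * M) else 0)" if "i \<in> insert k J" "j \<in> insert k J" for i j
  proof -
    have "i \<in> I" using that insert.prems by auto
    then have lin: "linear (\<alpha> i)" by (rule linear_root)
    show ?thesis
    proof (cases "j = k")
      case True
      then show ?thesis using that lk_k lk_J lin insert.hyps(2) by (auto simp: l'_def linear_scale)
    next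
      case False
      then have "j \<in> J" using that by auto
      then have "\<alpha> i (l' j) = of_int M * \<alpha> i (l j) - of_int (c j) * \<alpha> i lk"
        using lin False by (simp add: l'_def linear_scale linear_diff)
      then show ?thesis
        using that False \<open>j \<in> J\<close> lk_k lk_J c l insert.hyps(2) by (cases "i = k") auto
    qed
  qed
  moreover have "l' j \<in> Y" if "j \<in> insert k J" for j
    using that lY by (auto simp: l'_def intro!: Y_diff Y_scale lkY)
  moreover have "N * M \<noteq> 0" using N M v by auto
  ultimately show ?case by blast
qed

text \<open>Every simple root takes the value \<open>N\<close> on the sum of the dual family; the
  factor \<open>sgn N\<close> turns it into the positive integer
  \<open>\<bar>N\<bar>\<close>.\<close>

lemma dominant_coweight:
  obtains \<rho> where "\<rho> \<in> Y" "\<And>i. i \<in> I \<Longrightarrow> \<alpha> i \<rho> \<ge> 1"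
proof -
  obtain N :: int and l where N: "N \<noteq> 0" and lY: "\<And>j. j \<in> I \<Longrightarrow> l j \<in> Y"
    and l: "\<And>j i. j \<in> I \<Longrightarrow> i \<in> I \<Longrightarrow> \<alpha> i (l j) = (if i = j then of_int N else 0)"
    using dual_family[OF finite_I subset_refl] by blast
  define \<rho> where "\<rho> = of_int (sgn N) *\<^sub>R (\<Sum>j\<in>I. l j)"
  have "\<rho> \<in> Y" unfolding \<rho>_def by (intro Y_scale Y_sum lY)
  moreover have "\<alpha> i \<rho> \<ge> 1" if "i \<in> I" for i
  proof -
    have "\<alpha> i \<rho> = of_int (sgn N) * (\<Sum>j\<in>I. \<alpha> i (l j))"
      using linear_root[OF that] by (simp add: \<rho>_def linear_scale linear_sum)
    also have "(\<Sum>j\<in>I. \<alpha> i (l j)) = of_int N"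
      using l that finite_I by (simp cong: sum.cong)
    also have "of_int (sgn N) * of_int N = (of_int \<bar>N\<bar> :: real)"
      by (auto simp: sgn_if)
    finally show ?thesis using N by linarith
  qed
  ultimately show thesis using that by blast
qed

lemma fundamental_chamber_Y_plus: "\<nu> \<in> Y \<Longrightarrow> \<nu> \<in> closure fundamental_chamber \<Longrightarrow> \<nu> \<in> Y_plus"
  unfolding Y_plus_def tits_cone_def
  by (intro IntI UN_I[OF id_W]) auto

text \<open>The origin is the limit of shrinking multiples of a regular dominant coweight. It has to
  be in \<open>Y_plus\<close> so that the scalars \<open>scale c (Z 0)\<close> belong to
  \<open>H_space\<close>.\<close>

lemma zero_Y_plus: "0 \<in> Y_plus"
proof (intro fundamental_chamber_Y_plus Y_zero)
  obtain \<rho> where \<rho>: "\<rho> \<in> Y" "\<And>i. i \<in> I \<Longrightarrow> \<alpha> i \<rho> \<ge> 1" using dominant_coweight by blast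
  have "(\<lambda>n. inverse (real (Suc n)) *\<^sub>R \<rho>) \<longlonglongrightarrow> 0 *\<^sub>R \<rho>"
    by (intro tendsto_intros LIMSEQ_inverse_real_of_nat)
  then have lim: "(\<lambda>n. inverse (real (Suc n)) *\<^sub>R \<rho>) \<longlonglongrightarrow> 0"
    by (simp only: scaleR_zero_left)
  have "inverse (real (Suc n)) *\<^sub>R \<rho> \<in> fundamental_chamber" for n
    unfolding fundamental_chamber_def
  proof (intro CollectI ballI)
    fix i assume "i \<in> I"
    then show "\<alpha> i (inverse (real (Suc n)) *\<^sub>R \<rho>) > 0"
      using \<rho>(2)[of i] by (simp add: linear_scale[OF linear_root])
  qed
  with lim show "0 \<in> closure fundamental_chamber"
    unfolding closure_sequential by (intro exI[of _ "\<lambda>n. inverse (real (Suc n)) *\<^sub>R \<rho>"]) simp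
qed

text \<open>A large multiple of a regular dominant coweight outweighs the values of the simple roots
  on finitely many lattice points, so it pushes all of them into the fundamental chamber.\<close>

lemma translate_into_Y_plus:
  assumes "finite S" "S \<subseteq> Y"
  obtains \<mu> where "\<mu> \<in> Y_plus" "\<mu> \<in> Y" "\<And>\<nu>. \<nu> \<in> S \<Longrightarrow> \<mu> + \<nu> \<in> Y_plus"
proof -
  obtain \<rho> where \<rho>: "\<rho> \<in> Y" "\<And>i. i \<in> I \<Longrightarrow> \<alpha> i \<rho> \<ge> 1" using dominant_coweight by blast
  \<comment> \<open>A crude common bound for all \<open>\<bar>\<alpha> i \<nu>\<bar>\<close>; as a
    sum it also makes sense when \<open>S\<close> or \<open>I\<close> is empty.\<close>
  define b where "b = (\<Sum>\<nu>\<in>S. \<Sum>i\<in>I. \<bar>\<alpha> i \<nu>\<bar>)"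
  have b: "\<bar>\<alpha> i \<nu>\<bar> \<le> b" if "i \<in> I" "\<nu> \<in> S" for i \<nu>
  proof -
    have "\<bar>\<alpha> i \<nu>\<bar> \<le> (\<Sum>i\<in>I. \<bar>\<alpha> i \<nu>\<bar>)"
      using that finite_I by (intro member_le_sum) auto
    also have "\<dots> \<le> b"
      unfolding b_def using that assms
      by (intro member_le_sum[where f = "\<lambda>\<nu>. \<Sum>i\<in>I. \<bar>\<alpha> i \<nu>\<bar>"]) (auto intro: sum_nonneg)
    finally show ?thesis .
  qed
  \<comment> \<open>Adding 1 gives \<open>n > b\<close> strictly, and \<open>n > 0\<close> even when
    \<open>b = 0\<close>, so that \<open>\<mu>\<close> itself lies in the open chamber.\<close>
  define n where "n = \<lfloor>b\<rfloor> + 1"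
  have "b \<ge> 0" by (auto simp: b_def intro: sum_nonneg)
  then have n: "of_int n > b" "of_int n > (0::real)" unfolding n_def by linarith+
  define \<mu> where "\<mu> = of_int n *\<^sub>R \<rho>"
  have \<mu>: "\<alpha> i \<mu> \<ge> of_int n" if "i \<in> I" for i
    using \<rho>(2)[OF that] n mult_left_mono[of 1 "\<alpha> i \<rho>" "of_int n"]
    by (simp add: \<mu>_def linear_scale[OF linear_root[OF that]])
  have "\<mu> \<in> Y" unfolding \<mu>_def by (intro Y_scale \<rho>)
  moreover have "\<mu> \<in> fundamental_chamber"
    using \<mu> n(2) by (fastforce simp: fundamental_chamber_def)
  moreover have "\<mu> + \<nu> \<in> fundamental_chamber" if "\<nu> \<in> S" for \<nu>
    unfolding fundamental_chamber_def
  proof (intro CollectI ballI)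
    fix i assume "i \<in> I"
    then show "\<alpha> i (\<mu> + \<nu>) > 0"
      using \<mu>[of i] b[of i \<nu>] n(1) that by (simp add: linear_add[OF linear_root])
  qed
  ultimately show thesis
    using assms closure_subset by (intro that[of \<mu>]) (auto intro!: fundamental_chamber_Y_plus Y_add)
qed

end

section \<open>The Bernstein--Lusztig algebra\<close>

text \<open>Expands \<open>p\<close> into terms with a single key. All supports stay inside
  \<open>S\<close>, because the rules for the product are available only on
  \<open>BL_space\<close>.\<close>

lemma poly_mapping_span_induct [consumes 1, case_names zero single add]:
  fixes p :: "'b \<Rightarrow>\<^sub>0 'f::comm_monoid_add"
  assumes keys: "Poly_Mapping.keys p \<subseteq> S"
    and zero: "P 0"
    and single: "\<And>k c. k \<in> S \<Longrightarrow> P (Poly_Mapping.single k c)"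
    and add: "\<And>p q. Poly_Mapping.keys p \<subseteq> S \<Longrightarrow> Poly_Mapping.keys q \<subseteq> S \<Longrightarrow> P p \<Longrightarrow> P q \<Longrightarrow> P (p + q)"
  shows "P p"
proof -
  \<comment> \<open>The support bound is proved together with \<open>P\<close>, since the rule
    \<open>add\<close> asks for it on both summands.\<close>
  have *: "Poly_Mapping.keys (\<Sum>k\<in>T. Poly_Mapping.single k (Poly_Mapping.lookup p k)) \<subseteq> S \<and>
      P (\<Sum>k\<in>T. Poly_Mapping.single k (Poly_Mapping.lookup p k))"
    if "finite T" "T \<subseteq> S" for T
    using that
  proof (induction T rule: finite_induct)
    case empty
    then show ?case by (simp add: zero)
  next
    case (insert k T)
    have k: "Poly_Mapping.keys (Poly_Mapping.single k (Poly_Mapping.lookup p k)) \<subseteq> S"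
      using insert.prems by auto
    show ?case
      using insert add[OF k] single[of k] k
        order_trans[OF keys_add[of "Poly_Mapping.single k (Poly_Mapping.lookup p k)"] Un_least]
      by simp
  qed
  have "(\<Sum>k\<in>Poly_Mapping.keys p. Poly_Mapping.single k (Poly_Mapping.lookup p k)) = p"
    by (rule poly_mapping_eqI)
      (simp add: lookup_sum lookup_single when_def in_keys_iff)
  then show ?thesis
    using *[OF finite_keys keys] by simp
qed

lemma lookup_scale: "Poly_Mapping.lookup (scale c p) k = c * Poly_Mapping.lookup p k"
  unfolding scale_def by transfer (simp add: when_def)

lemma keys_scale: "Poly_Mapping.keys (scale c p) \<subseteq> Poly_Mapping.keys p"
  by (auto simp: in_keys_iff lookup_scale)

lemma scale_add_right: "scale c (p + q) = scale c p + scale c q"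
  by (rule poly_mapping_eqI) (simp add: lookup_scale lookup_add algebra_simps)

lemma scale_scale: "scale c (scale d p) = scale (c * d) p"
  by (rule poly_mapping_eqI) (simp add: lookup_scale)

lemma scale_one [simp]: "scale 1 p = p"
  by (rule poly_mapping_eqI) (simp add: lookup_scale)

lemma scale_single: "scale c (Poly_Mapping.single k d) = Poly_Mapping.single k (c * d)"
  by (rule poly_mapping_eqI) (simp add: lookup_scale lookup_single when_def)

section \<open>Linearity of the product, the commutative part \<open>FY\<close>, and shifts into
  \<open>H_space\<close>\<close>

context BL_hecke_algebra
begin

lemma BL_zero: "0 \<in> BL_space"
  by (simp add: BL_space_def)

lemma BL_add: "p \<in> BL_space \<Longrightarrow> q \<in> BL_space \<Longrightarrow> p + q \<in> BL_space"
  using keys_add[of p q] by (auto simp: BL_space_def)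

lemma BL_diff: "p \<in> BL_space \<Longrightarrow> q \<in> BL_space \<Longrightarrow> p - q \<in> BL_space"
  using keys_diff[of p q] by (auto simp: BL_space_def)

lemma BL_scale: "p \<in> BL_space \<Longrightarrow> scale c p \<in> BL_space"
  using keys_scale[of c p] by (auto simp: BL_space_def)

lemma BL_ZH: "\<nu> \<in> Y \<Longrightarrow> w \<in> W \<Longrightarrow> ZH \<nu> w \<in> BL_space"
  by (auto simp: BL_space_def ZH_def)

lemma BL_Z: "\<nu> \<in> Y \<Longrightarrow> Z \<nu> \<in> BL_space"
  by (intro BL_ZH id_W)

lemma BL_H: "w \<in> W \<Longrightarrow> H w \<in> BL_space"
  by (intro BL_ZH Y_zero)

lemma FY_BL: "q \<in> FY \<Longrightarrow> q \<in> BL_space"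
  using id_W by (fastforce simp: BL_space_def FY_def)

lemma FY_Z: "\<nu> \<in> Y \<Longrightarrow> Z \<nu> \<in> FY"
  by (auto simp: FY_def ZH_def)

lemma FY_diff: "p \<in> FY \<Longrightarrow> q \<in> FY \<Longrightarrow> p - q \<in> FY"
  using keys_diff[of p q] by (auto simp: FY_def)

lemma FY_scale: "p \<in> FY \<Longrightarrow> scale c p \<in> FY"
  using keys_scale[of c p] by (fastforce simp: FY_def)

lemma FY_uminus: "p \<in> FY \<Longrightarrow> - p \<in> FY"
  by (simp add: FY_def)

lemma H_space_subset: "H_space \<subseteq> BL_space"
  by (auto simp: H_space_def BL_space_def Y_plus_def)

lemma single_eq_scale: "Poly_Mapping.single (\<nu>, w) c = scale c (ZH \<nu> w)"
  by (simp add: ZH_def scale_single)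

lemma zero_prd: "p \<in> BL_space \<Longrightarrow> 0 \<star> p = 0"
  using add_left[of 0 0 p] BL_zero by simp

lemma prd_zero: "p \<in> BL_space \<Longrightarrow> p \<star> 0 = 0"
  using add_right[of 0 0 p] BL_zero by simp

lemma diff_left: "p \<in> BL_space \<Longrightarrow> q \<in> BL_space \<Longrightarrow> u \<in> BL_space \<Longrightarrow> (p - q) \<star> u = p \<star> u - q \<star> u"
  using add_left[of "p - q" q u] BL_diff[of p q] by simp

lemma diff_right: "p \<in> BL_space \<Longrightarrow> q \<in> BL_space \<Longrightarrow> u \<in> BL_space \<Longrightarrow> u \<star> (p - q) = u \<star> p - u \<star> q"
  using add_right[of "p - q" q u] BL_diff[of p q] by simp

lemma uminus_left: "p \<in> BL_space \<Longrightarrow> u \<in> BL_space \<Longrightarrow> (- p) \<star> u = - (p \<star> u)"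
  using diff_left[of 0 p u] BL_zero by (simp add: zero_prd)

lemma Z_ZH: "\<nu> \<in> Y \<Longrightarrow> \<mu> \<in> Y \<Longrightarrow> w \<in> W \<Longrightarrow> Z \<nu> \<star> ZH \<mu> w = ZH (\<nu> + \<mu>) w"
  using assoc[of "Z \<nu>" "Z \<mu>" "H w"] by (simp add: BL_Z BL_H Z_H Z_Z Y_add)

lemma BL_induct [consumes 1, case_names zero ZH add]:
  assumes "p \<in> BL_space" "P 0"
    and "\<And>c \<nu> w. \<nu> \<in> Y \<Longrightarrow> w \<in> W \<Longrightarrow> P (scale c (ZH \<nu> w))"
    and "\<And>p q. p \<in> BL_space \<Longrightarrow> q \<in> BL_space \<Longrightarrow> P p \<Longrightarrow> P q \<Longrightarrow> P (p + q)"
  shows "P p"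
proof -
  have "Poly_Mapping.keys p \<subseteq> Y \<times> W" using assms(1) by (simp add: BL_space_def)
  then show ?thesis
    by (induction p rule: poly_mapping_span_induct)
      (use assms in \<open>auto simp: single_eq_scale BL_space_def\<close>)
qed

text \<open>The left unit law is not an axiom; it follows from \<open>Z_ZH\<close> on basis vectors
  by linearity.\<close>

lemma Z_zero_prd: "p \<in> BL_space \<Longrightarrow> Z 0 \<star> p = p"
proof (induction p rule: BL_induct)
  case zero
  show "Z 0 \<star> 0 = 0"
    by (simp add: prd_zero BL_Z Y_zero)
next
  case (ZH c \<nu> w)
  then show "Z 0 \<star> scale c (ZH \<nu> w) = scale c (ZH \<nu> w)"
    by (simp add: scale_right BL_Z BL_ZH Y_zero Z_ZH)
next
  case (add p q)
  have "Z 0 \<star> p = p" "Z 0 \<star> q = q" by (rule add.IH)+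
  then show "Z 0 \<star> (p + q) = p + q"
    using add.hyps by (simp add: add_right BL_Z Y_zero)
qed

lemma FY_commute: "\<nu> \<in> Y \<Longrightarrow> q \<in> FY \<Longrightarrow> Z \<nu> \<star> q = q \<star> Z \<nu>"
proof -
  assume \<nu>: "\<nu> \<in> Y" and "q \<in> FY"
  then have "Poly_Mapping.keys q \<subseteq> Y \<times> {id}" by (simp add: FY_def)
  then show "Z \<nu> \<star> q = q \<star> Z \<nu>"
  proof (induction q rule: poly_mapping_span_induct)
    case zero
    show "Z \<nu> \<star> 0 = 0 \<star> Z \<nu>" using \<nu> by (simp add: prd_zero zero_prd BL_Z)
  next
    case (single k c)
    then show "Z \<nu> \<star> Poly_Mapping.single k c = Poly_Mapping.single k c \<star> Z \<nu>"
      using \<nu> by (auto simp: single_eq_scale scale_left scale_right BL_Z Z_Z add.commute)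
  next
    case (add p q)
    then have "p \<in> BL_space" "q \<in> BL_space" by (auto intro: FY_BL simp: FY_def)
    moreover have "Z \<nu> \<star> p = p \<star> Z \<nu>" "Z \<nu> \<star> q = q \<star> Z \<nu>" by (rule add.IH)+
    ultimately show "Z \<nu> \<star> (p + q) = (p + q) \<star> Z \<nu>"
      using \<nu> by (simp add: add_left add_right BL_Z)
  qed
qed

lemma scale_Z_prd: "p \<in> BL_space \<Longrightarrow> scale c (Z 0) \<star> p = scale c p"
  by (simp add: scale_left BL_Z Y_zero Z_zero_prd)

text \<open>Left multiplication by \<open>Z \<mu>\<close> only translates the lattice part of the
  support. That support is finite, so a single \<open>\<mu>\<close> moves all of it into
  \<open>Y_plus\<close>.\<close>

lemma shift_into_H_space:
  assumes "h \<in> BL_space"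
  obtains \<mu> where "\<mu> \<in> Y_plus" "\<mu> \<in> Y" "Z \<mu> \<star> h \<in> H_space"
proof -
  define S where "S = fst ` Poly_Mapping.keys h"
  have "finite S" "S \<subseteq> Y"
    using assms by (auto simp: S_def BL_space_def)
  then obtain \<mu> where \<mu>: "\<mu> \<in> Y_plus" "\<mu> \<in> Y" "\<And>\<nu>. \<nu> \<in> S \<Longrightarrow> \<mu> + \<nu> \<in> Y_plus"
    using translate_into_Y_plus by blast
  \<comment> \<open>The induction runs over \<open>S \<times> W\<close> and not over
    \<open>Y \<times> W\<close>, because \<open>\<mu>\<close> was chosen for the points of
    \<open>S\<close> only.\<close>
  have "Poly_Mapping.keys h \<subseteq> S \<times> W"
    using assms by (force simp: S_def BL_space_def)
  then have "Z \<mu> \<star> h \<in> H_space"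
  proof (induction h rule: poly_mapping_span_induct)
    case zero
    show "Z \<mu> \<star> 0 \<in> H_space" using \<mu> by (simp add: prd_zero BL_Z H_space_def)
  next
    case (single k c)
    then have "Z \<mu> \<star> Poly_Mapping.single k c = scale c (ZH (\<mu> + fst k) (snd k))"
      using \<mu> \<open>S \<subseteq> Y\<close> by (auto simp: single_eq_scale scale_right BL_Z BL_ZH Z_ZH)
    then show "Z \<mu> \<star> Poly_Mapping.single k c \<in> H_space"
      using single \<mu>(3)[of "fst k"] by (auto simp: H_space_def ZH_def scale_single)
  next
    case (add p q)
    then have "p \<in> BL_space" "q \<in> BL_space" using \<open>S \<subseteq> Y\<close> by (auto simp: BL_space_def)
    moreover have "Z \<mu> \<star> p \<in> H_space" "Z \<mu> \<star> q \<in> H_space" by (rule add.IH)+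
    ultimately show "Z \<mu> \<star> (p + q) \<in> H_space"
      using \<mu> keys_add[of "Z \<mu> \<star> p" "Z \<mu> \<star> q"] by (auto simp: add_right BL_Z H_space_def)
  qed
  then show thesis using that \<mu> by blast
qed

end

section \<open>Inverting translations modulo a left ideal\<close>

text \<open>\<open>N\<close> stands for the kernel of \<open>p \<mapsto> p \<otimes> 1\<close> onto the principal series.\<close>

locale principal_series_kernel = BL_hecke_algebra I a Y \<alpha> \<alpha>v \<sigma> \<sigma>' prd
  for I :: "'i set" and a :: "'i \<Rightarrow> 'i \<Rightarrow> int" and Y :: "'v::real_normed_vector set"
    and \<alpha> :: "'i \<Rightarrow> 'v \<Rightarrow> real" and \<alpha>v :: "'i \<Rightarrow> 'v" and \<sigma> \<sigma>' :: "'i \<Rightarrow> 'f::field_char_0"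
    and prd :: "('v \<times> ('v \<Rightarrow> 'v) \<Rightarrow>\<^sub>0 'f) \<Rightarrow> ('v \<times> ('v \<Rightarrow> 'v) \<Rightarrow>\<^sub>0 'f) \<Rightarrow> ('v \<times> ('v \<Rightarrow> 'v) \<Rightarrow>\<^sub>0 'f)"
      (infixl \<open>\<star>\<close> 70) +
  fixes N :: "('v \<times> ('v \<Rightarrow> 'v) \<Rightarrow>\<^sub>0 'f) set" and \<tau> :: "'v \<Rightarrow> 'f"
  assumes N_BL: "N \<subseteq> BL_space"
    and N_add: "\<And>p q. p \<in> N \<Longrightarrow> q \<in> N \<Longrightarrow> p + q \<in> N"
    and N_left: "\<And>h p. h \<in> BL_space \<Longrightarrow> p \<in> N \<Longrightarrow> h \<star> p \<in> N"
    and \<tau>_nonzero: "\<And>\<nu>. \<nu> \<in> Y \<Longrightarrow> \<tau> \<nu> \<noteq> 0"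
    and N_char: "\<And>\<nu>. \<nu> \<in> Y \<Longrightarrow> Z \<nu> - scale (\<tau> \<nu>) (Z 0) \<in> N"
begin

text \<open>Says that finitely many factors \<open>Z \<nu> - c\<close> with nonzero, possibly
  different \<open>c\<close> carry \<open>p\<close> into \<open>N\<close>. Their product is a
  polynomial in \<open>Z \<nu>\<close> with nonzero constant term, which is what makes
  \<open>Z \<nu>\<close> invertible on the class of \<open>p\<close>. The inductive form allows
  induction on the factors.\<close>

inductive annihilated :: "'v \<Rightarrow> ('v \<times> ('v \<Rightarrow> 'v) \<Rightarrow>\<^sub>0 'f) \<Rightarrow> bool" for \<nu> where
  base: "p \<in> N \<Longrightarrow> annihilated \<nu> p"
| step: "p \<in> BL_space \<Longrightarrow> c \<noteq> 0 \<Longrightarrow> annihilated \<nu> (Z \<nu> \<star> p - scale c p) \<Longrightarrow> annihilated \<nu> p"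

text \<open>Elements of \<open>FY\<close> commute with \<open>Z \<nu>\<close>, so the factors that
  serve for \<open>p\<close> serve for \<open>q \<star> p\<close> as well.\<close>

lemma annihilated_FY:
  assumes "annihilated \<nu> p" "\<nu> \<in> Y" "q \<in> FY"
  shows "annihilated \<nu> (q \<star> p)"
  using assms(1)
proof (induction rule: annihilated.induct)
  case (base p)
  then show ?case using assms FY_BL N_left annihilated.base by blast
next
  case (step p c)
  have q: "q \<in> BL_space" "Z \<nu> \<in> BL_space" using assms FY_BL BL_Z by auto
  have "Z \<nu> \<star> (q \<star> p) = q \<star> (Z \<nu> \<star> p)"
    using step.hyps(1) q FY_commute[OF assms(2,3)] by (simp flip: assoc)
  then have "Z \<nu> \<star> (q \<star> p) - scale c (q \<star> p) = q \<star> (Z \<nu> \<star> p - scale c p)"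
    using step.hyps(1) q by (simp add: diff_right scale_right closed BL_scale)
  moreover have "annihilated \<nu> (q \<star> (Z \<nu> \<star> p - scale c p))"
    by (rule step.IH)
  ultimately show ?case
    using annihilated.step[OF closed[OF q(1) step.hyps(1)] step.hyps(2)] by simp
qed

lemma annihilated_BL: "annihilated \<nu> p \<Longrightarrow> p \<in> BL_space"
  by (induction rule: annihilated.induct) (use N_BL in auto)

text \<open>Apply the factors for \<open>p\<close> to the sum, then those that remain for the second
  summand.\<close>

lemma annihilated_add:
  assumes "annihilated \<nu> p" "annihilated \<nu> q" "\<nu> \<in> Y"
  shows "annihilated \<nu> (p + q)"
proof -
  have split: "Z \<nu> \<star> (p + q) - scale c (p + q) = (Z \<nu> \<star> p - scale c p) + (Z \<nu> \<star> q - scale c q)"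
    if "p \<in> BL_space" "q \<in> BL_space" for p q c
    using that assms(3) by (simp add: add_right BL_Z scale_add_right)
  have factor: "Z \<nu> \<star> p - scale c p = (Z \<nu> - scale c (Z 0)) \<star> p" if "p \<in> BL_space" for p c
    using that assms(3) by (simp add: diff_left BL_Z BL_scale Y_zero scale_Z_prd)
  have FY: "Z \<nu> - scale c (Z 0) \<in> FY" for c
    using assms(3) by (intro FY_diff FY_scale FY_Z Y_zero)
  \<comment> \<open>Once the first summand is in \<open>N\<close>, it stays there under every
    further factor, because \<open>N\<close> is a left ideal.\<close>
  have N: "annihilated \<nu> (p + q)" if "annihilated \<nu> q" "p \<in> N" for p q
    using that
  proof (induction arbitrary: p rule: annihilated.induct)
    case (base q)
    then show ?case using N_add annihilated.base by blast
  next
    case (step q c)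
    have p: "p \<in> BL_space" using step.prems N_BL by auto
    have "Z \<nu> \<star> p - scale c p \<in> N"
      using factor[OF p] FY FY_BL N_left step.prems by metis
    then have "annihilated \<nu> (Z \<nu> \<star> (p + q) - scale c (p + q))"
      unfolding split[OF p step.hyps(1)] by (rule step.IH)
    then show ?case
      by (rule annihilated.step[OF BL_add[OF p step.hyps(1)] step.hyps(2)])
  qed
  show ?thesis
    using assms(1,2)
  proof (induction arbitrary: q rule: annihilated.induct)
    case (base p)
    then show ?case by (intro N)
  next
    case (step p c)
    have q: "q \<in> BL_space" using step.prems annihilated_BL by auto
    \<comment> \<open>The factor meant for \<open>p\<close> also hits \<open>q\<close>. It lies in
      \<open>FY\<close>, so the result is still annihilated.\<close>
    have "annihilated \<nu> (Z \<nu> \<star> q - scale c q)"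
      using factor[OF q] FY annihilated_FY[OF step.prems assms(3)] by metis
    then have "annihilated \<nu> (Z \<nu> \<star> (p + q) - scale c (p + q))"
      unfolding split[OF step.hyps(1) q] by (rule step.IH)
    then show ?case
      by (rule annihilated.step[OF BL_add[OF step.hyps(1) q] step.hyps(2)])
  qed
qed

text \<open>The Bernstein--Lusztig relation turns a factor for \<open>Z \<nu>\<close> on
  \<open>p\<close> into the same factor for \<open>Z (r i \<nu>)\<close> on
  \<open>H (r i) \<star> p\<close>, up to an error in \<open>FY \<star> p\<close>. The first
  hypothesis drives the induction; the second, at \<open>r i \<nu>\<close>, handles the
  error.\<close>

lemma annihilated_H:
  assumes "annihilated \<nu> p" "\<forall>\<mu>\<in>Y. annihilated \<mu> p" "i \<in> I" "\<nu> \<in> Y"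
  shows "annihilated (r i \<nu>) (H (r i) \<star> p)"
  using assms(1,2)
proof (induction rule: annihilated.induct)
  case (base p)
  then show ?case
    using assms(3) BL_H r_W N_left annihilated.base by blast
next
  case (step p c)
  have BL: "H (r i) \<in> BL_space" "Z \<nu> \<in> BL_space" "Z (r i \<nu>) \<in> BL_space" "p \<in> BL_space"
    using assms step.hyps BL_H r_W BL_Z r_Y by auto
  obtain q where q: "q \<in> FY" "H (r i) \<star> Z \<nu> - Z (r i \<nu>) \<star> H (r i) = q"
    using H_Z[OF assms(3,4)] by blast
  then have "Z (r i \<nu>) \<star> H (r i) = H (r i) \<star> Z \<nu> - q" by (simp add: algebra_simps)
  then have "(Z (r i \<nu>) \<star> H (r i)) \<star> p = (H (r i) \<star> Z \<nu>) \<star> p - q \<star> p"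
    using BL q FY_BL by (simp add: diff_left closed)
  then have eq: "Z (r i \<nu>) \<star> (H (r i) \<star> p) - scale c (H (r i) \<star> p)
      = H (r i) \<star> (Z \<nu> \<star> p - scale c p) + (- q) \<star> p"
    using BL q FY_BL by (simp add: assoc diff_right scale_right closed BL_scale uminus_left)
  \<comment> \<open>The hypothesis on all \<open>\<mu>\<close> must pass from \<open>p\<close> to
    \<open>Z \<nu> \<star> p - scale c p\<close> before the induction hypothesis can be
    used.\<close>
  have "annihilated \<mu> (Z \<nu> \<star> p - scale c p)" if "\<mu> \<in> Y" for \<mu>
  proof -
    have "Z \<nu> \<star> p - scale c p = (Z \<nu> - scale c (Z 0)) \<star> p"
      using BL by (simp add: diff_left BL_Z BL_scale Y_zero scale_Z_prd)
    then show ?thesis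
      using annihilated_FY[of \<mu> p "Z \<nu> - scale c (Z 0)"] step.prems that assms(4)
      by (auto intro: FY_diff FY_scale FY_Z Y_zero)
  qed
  then have "annihilated (r i \<nu>) (H (r i) \<star> (Z \<nu> \<star> p - scale c p))"
    using step.IH by blast
  moreover have "annihilated (r i \<nu>) ((- q) \<star> p)"
    using annihilated_FY[of "r i \<nu>" p "- q"] step.prems assms r_Y q FY_uminus by auto
  ultimately have "annihilated (r i \<nu>) (Z (r i \<nu>) \<star> (H (r i) \<star> p) - scale c (H (r i) \<star> p))"
    unfolding eq using assms r_Y by (intro annihilated_add) auto
  then show ?case
    by (rule annihilated.step[OF closed[OF BL(1,4)] step.hyps(2)])
qed

text \<open>\<open>Z \<nu>\<close> acts on the class of \<open>Z 0\<close>, which is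
  \<open>H id\<close>, by the nonzero scalar \<open>\<tau> \<nu>\<close>; induction on the length
  spreads this to every \<open>H w\<close>.\<close>

lemma annihilated_H_W: "w \<in> W \<Longrightarrow> \<forall>\<nu>\<in>Y. annihilated \<nu> (H w)"
proof (induction rule: W_length_induct)
  case id
  show ?case
  proof
    fix \<nu> assume \<nu>: "\<nu> \<in> Y"
    then have "annihilated \<nu> (Z \<nu> \<star> Z 0 - scale (\<tau> \<nu>) (Z 0))"
      by (simp add: Z_Z Y_zero annihilated.base N_char)
    then show "annihilated \<nu> (H id)"
      by (rule annihilated.step[OF BL_Z[OF Y_zero] \<tau>_nonzero[OF \<nu>]])
  qed
next
  case (step i w)
  show ?case
  proof
    fix \<nu> assume "\<nu> \<in> Y"
    \<comment> \<open>Used at \<open>r i \<nu>\<close>, because \<open>r i\<close> is an involution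
      and sends it back to \<open>\<nu>\<close>.\<close>
    then show "annihilated \<nu> (H (r i \<circ> w))"
      using annihilated_H[of "r i \<nu>" "H w" i] step r_Y by (simp add: r_r H_H_up)
  qed
qed

text \<open>Basis vectors factor as \<open>Z \<mu> \<star> H w\<close> with the left factor in
  \<open>FY\<close>, so closure under \<open>FY\<close> and under sums reduces everything to the
  \<open>H w\<close>.\<close>

lemma annihilated_BL_space: "p \<in> BL_space \<Longrightarrow> \<nu> \<in> Y \<Longrightarrow> annihilated \<nu> p"
proof (induction rule: BL_induct)
  case zero
  have "0 \<in> N"
    using N_left[OF BL_zero N_char[OF Y_zero]] by (simp add: zero_prd BL_diff BL_scale BL_Z Y_zero)
  then show ?case by (rule annihilated.base)
next
  case (ZH c \<mu> w)
  have "annihilated \<nu> (scale c (Z \<mu>) \<star> H w)"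
    using ZH annihilated_H_W by (intro annihilated_FY FY_scale FY_Z) auto
  then show ?case
    using ZH by (simp add: scale_left BL_Z BL_H Z_H)
next
  case (add p q)
  then show ?case by (intro annihilated_add) auto
qed

text \<open>Since \<open>c \<noteq> 0\<close>, one can solve \<open>Z\<^sup>\<nu> p - c p = p'\<close> for \<open>Z\<^sup>-\<^sup>\<nu> p\<close>.\<close>

lemma annihilated_inverse:
  assumes "annihilated \<nu> p" "p \<in> M" "\<nu> \<in> Y" "N \<subseteq> M"
    and diff: "\<And>p q. p \<in> M \<Longrightarrow> q \<in> M \<Longrightarrow> p - q \<in> M"
    and scale: "\<And>c p. p \<in> M \<Longrightarrow> scale c p \<in> M"
    and Z: "\<And>p. p \<in> M \<Longrightarrow> Z \<nu> \<star> p \<in> M"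
  shows "Z (- \<nu>) \<star> p \<in> M"
  using assms(1,2)
proof (induction rule: annihilated.induct)
  case (base p)
  then show ?case using N_left BL_Z Y_minus assms(3,4) by blast
next
  case (step p c)
  have BL: "Z \<nu> \<in> BL_space" "Z (- \<nu>) \<in> BL_space" using assms(3) BL_Z Y_minus by auto
  let ?x = "Z (- \<nu>) \<star> (Z \<nu> \<star> p - scale c p)"
  \<comment> \<open>\<open>M\<close> is stable under \<open>Z \<nu> - c\<close>, so the induction
    hypothesis covers the vector with one factor fewer.\<close>
  have x: "?x \<in> M" using step.IH step.prems diff scale Z by blast
  have "Z (- \<nu>) \<star> (Z \<nu> \<star> p) = p"
    using step.hyps BL assms(3) by (simp add: Z_Z Y_minus Z_zero_prd flip: assoc)
  then have "?x = p - scale c (Z (- \<nu>) \<star> p)"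
    using step.hyps BL by (simp add: diff_right scale_right closed BL_scale)
  then have "scale c (Z (- \<nu>) \<star> p) = p - ?x" by simp
  then have "Z (- \<nu>) \<star> p = scale (inverse c) (p - ?x)"
    using step.hyps(2) scale_scale[of "inverse c" c "Z (- \<nu>) \<star> p"] by simp
  then show "Z (- \<nu>) \<star> p \<in> M"
    using scale[OF diff[OF step.prems x]] by simp
qed

text \<open>Write \<open>h \<star> p\<close> as \<open>Z (- \<mu>)\<close> applied to
  \<open>(Z \<mu> \<star> h) \<star> p\<close>. With \<open>Z \<mu> \<star> h\<close> in
  \<open>H_space\<close> the inner vector is in \<open>M\<close>, and
  \<open>annihilated_inverse\<close> lets \<open>Z (- \<mu>)\<close> act within
  \<open>M\<close>.\<close>

lemma H_space_stable_imp_BL_space_stable: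
  assumes "p \<in> M" "h \<in> BL_space" "M \<subseteq> BL_space" "N \<subseteq> M"
    and diff: "\<And>p q. p \<in> M \<Longrightarrow> q \<in> M \<Longrightarrow> p - q \<in> M"
    and stable: "\<And>h p. h \<in> H_space \<Longrightarrow> p \<in> M \<Longrightarrow> h \<star> p \<in> M"
  shows "h \<star> p \<in> M"
proof -
  obtain \<mu> where \<mu>: "\<mu> \<in> Y_plus" "\<mu> \<in> Y" "Z \<mu> \<star> h \<in> H_space"
    using shift_into_H_space assms(2) by blast
  have H: "scale c (Z \<nu>) \<in> H_space" if "\<nu> \<in> Y_plus" for c \<nu>
    using that id_W by (auto simp: H_space_def ZH_def scale_single)
  \<comment> \<open>Scalars act as \<open>scale c (Z 0)\<close>, an element of
    \<open>H_space\<close>; hence an additive subgroup stable under \<open>H_space\<close> is a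
    subspace.\<close>
  have scale: "scale c q \<in> M" if "q \<in> M" for c q
    using stable[OF H[OF zero_Y_plus] that] assms(3) that by (auto simp: scale_Z_prd subset_iff)
  have Z: "Z \<mu> \<star> q \<in> M" if "q \<in> M" for q
    using stable[OF H[OF \<mu>(1), of 1] that] by simp
  let ?y = "(Z \<mu> \<star> h) \<star> p"
  have p: "p \<in> BL_space" using assms by auto
  have y: "?y \<in> M" using stable \<mu> assms(1) by blast
  have "Z (- \<mu>) \<star> ?y \<in> M"
    using y \<mu>(2) assms(3,4) diff scale Z
    by (intro annihilated_inverse[OF annihilated_BL_space]) auto
  moreover have "Z (- \<mu>) \<star> ?y = h \<star> p"
    using p assms(2) \<mu>(2) by (simp add: BL_Z Y_minus closed Z_Z Z_zero_prd flip: assoc)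
  ultimately show ?thesis by simp
qed

end

section \<open>The principal series\<close>

text \<open>The closure conditions place the defining relations inside the free abelian group on
  \<open>M \<times> N\<close>, so the subgroup generated there is normal and the quotient is a
  group.\<close>

locale tensor_factors =
  fixes M :: "'m::ab_group_add set" and N :: "'n::ab_group_add set" and R :: "'r set"
    and ract :: "'m \<Rightarrow> 'r \<Rightarrow> 'm" and lact :: "'r \<Rightarrow> 'n \<Rightarrow> 'n"
  assumes M_add: "\<And>m m'. m \<in> M \<Longrightarrow> m' \<in> M \<Longrightarrow> m + m' \<in> M"
    and N_add: "\<And>n n'. n \<in> N \<Longrightarrow> n' \<in> N \<Longrightarrow> n + n' \<in> N"
    and ract_closed: "\<And>m x. m \<in> M \<Longrightarrow> x \<in> R \<Longrightarrow> ract m x \<in> M"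
    and lact_closed: "\<And>x n. x \<in> R \<Longrightarrow> n \<in> N \<Longrightarrow> lact x n \<in> N"
begin

abbreviation "F \<equiv> free_Abelian_group (M \<times> N)"
abbreviation "rels \<equiv> tensor_relations M N R ract lact"
abbreviation "K \<equiv> tensor_kernel M N R ract lact"
abbreviation "T \<equiv> tensor_product M N R ract lact"

lemma relations_carrier: "rels \<subseteq> carrier F"
  using order_trans[OF keys_diff]
  by (auto simp: tensor_relations_def M_add N_add ract_closed lact_closed keys_frag_of
      dest!: subsetD[OF keys_diff])

lemma subgroup_kernel: "subgroup K F"
  unfolding tensor_kernel_def
  by (rule group.generate_is_subgroup[OF group_free_Abelian_group relations_carrier])

lemma normal_kernel: "K \<lhd> F"
  by (rule comm_group.subgroup_imp_normal[OF abelian_free_Abelian_group subgroup_kernel])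

lemma group_tensor_product: "group T"
  unfolding tensor_product_def by (rule normal.factorgroup_is_group[OF normal_kernel])

lemma kernel_keys: "x \<in> K \<Longrightarrow> Poly_Mapping.keys x \<subseteq> M \<times> N"
  using subgroup.mem_carrier[OF subgroup_kernel, of x] by simp

lemma kernel_add: "x \<in> K \<Longrightarrow> y \<in> K \<Longrightarrow> x + y \<in> K"
  using subgroup.m_closed[OF subgroup_kernel, of x y] by simp

lemma kernel_minus: "x \<in> K \<Longrightarrow> - x \<in> K"
  using subgroup.m_inv_closed[OF subgroup_kernel, of x] kernel_keys[of x] by simp

lemma kernel_relation: "x \<in> rels \<Longrightarrow> x \<in> K"
  unfolding tensor_kernel_def by (rule generate.incl)

lemma coset_eq:
  assumes "x \<in> carrier F" "y \<in> carrier F" "x - y \<in> K"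
  shows "K #>\<^bsub>F\<^esub> x = K #>\<^bsub>F\<^esub> y"
proof -
  have "x \<in> K #>\<^bsub>F\<^esub> y"
    using assms(3) by (auto simp: r_coset_def intro!: bexI[of _ "x - y"])
  then show ?thesis
    using group.repr_independence[OF group_free_Abelian_group _ assms(2) subgroup_kernel] by blast
qed

lemma coset_hom: "(\<lambda>x. K #>\<^bsub>F\<^esub> x) \<in> hom F T"
  unfolding tensor_product_def by (rule normal.r_coset_hom_Mod[OF normal_kernel])

lemma carrier_tensor_product: "carrier T = (\<lambda>x. K #>\<^bsub>F\<^esub> x) ` carrier F"
  by (auto simp: tensor_product_def FactGroup_def RCOSETS_def)

lemma coset_diff:
  assumes "x \<in> carrier F" "y \<in> carrier F"
  shows "K #>\<^bsub>F\<^esub> (x - y) = (K #>\<^bsub>F\<^esub> x) \<otimes>\<^bsub>T\<^esub> inv\<^bsub>T\<^esub> (K #>\<^bsub>F\<^esub> y)"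
proof -
  interpret group_hom F T "\<lambda>x. K #>\<^bsub>F\<^esub> x"
    by (intro group_hom.intro group_hom_axioms.intro coset_hom group_tensor_product) simp
  have "x - y = x \<otimes>\<^bsub>F\<^esub> inv\<^bsub>F\<^esub> y" using assms by simp
  then show ?thesis
    using assms by (simp only: hom_mult hom_inv G.inv_closed)
qed

text \<open>The elements mapped into \<open>K\<close> form a subgroup, and a right-linear
  \<open>f\<close> sends each defining relation to a relation of the same kind.\<close>

lemma frag_extend_kernel:
  assumes f: "\<And>m. m \<in> M \<Longrightarrow> f m \<in> M" "\<And>m m'. m \<in> M \<Longrightarrow> m' \<in> M \<Longrightarrow> f (m + m') = f m + f m'"
      "\<And>m x. m \<in> M \<Longrightarrow> x \<in> R \<Longrightarrow> f (ract m x) = ract (f m) x"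
    and "x \<in> K"
  shows "frag_extend (\<lambda>(m, n). frag_of (f m, n)) x \<in> K"
proof -
  let ?f = "frag_extend (\<lambda>(m, n). frag_of (f m, n))"
  have "subgroup {x \<in> carrier F. ?f x \<in> K} F"
  proof
    show "\<one>\<^bsub>F\<^esub> \<in> {x \<in> carrier F. ?f x \<in> K}"
      using subgroup.one_closed[OF subgroup_kernel] by simp
  next
    fix x y assume "x \<in> {x \<in> carrier F. ?f x \<in> K}" "y \<in> {x \<in> carrier F. ?f x \<in> K}"
    then show "x \<otimes>\<^bsub>F\<^esub> y \<in> {x \<in> carrier F. ?f x \<in> K}"
      using keys_add[of x y] by (auto simp: frag_extend_add kernel_add)
  next
    fix x assume "x \<in> {x \<in> carrier F. ?f x \<in> K}"
    then show "inv\<^bsub>F\<^esub> x \<in> {x \<in> carrier F. ?f x \<in> K}"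
      by (auto simp: frag_extend_minus kernel_minus)
  qed auto
  moreover have "?f x \<in> rels" if "x \<in> rels" for x
    using that unfolding tensor_relations_def
    by (elim UnE CollectE exE conjE; simp add: frag_extend_diff f) (use f in blast)+
  ultimately have "generate F rels \<subseteq> {x \<in> carrier F. ?f x \<in> K}"
    using relations_carrier kernel_relation
    by (intro group.generate_subgroup_incl[OF group_free_Abelian_group])
      (auto simp del: carrier_free_Abelian_group_iff)
  then show ?thesis
    using assms(4) unfolding tensor_kernel_def by blast
qed

text \<open>The union over representatives collapses to one coset: two representatives differ by an
  element of \<open>K\<close>, and its image is again in \<open>K\<close>.\<close>

lemma tensor_map_left_coset:
  assumes f: "\<And>m. m \<in> M \<Longrightarrow> f m \<in> M" "\<And>m m'. m \<in> M \<Longrightarrow> m' \<in> M \<Longrightarrow> f (m + m') = f m + f m'"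
      "\<And>m x. m \<in> M \<Longrightarrow> x \<in> R \<Longrightarrow> f (ract m x) = ract (f m) x"
    and "x \<in> carrier F"
  shows "tensor_map_left M N R ract lact f (K #>\<^bsub>F\<^esub> x) =
    K #>\<^bsub>F\<^esub> frag_extend (\<lambda>(m, n). frag_of (f m, n)) x"
proof -
  let ?f = "frag_extend (\<lambda>(m, n). frag_of (f m, n))"
  have carrier: "?f y \<in> carrier F" if "y \<in> carrier F" for y
  proof -
    have "Poly_Mapping.keys y \<subseteq> M \<times> N" using that by simp
    then have "Poly_Mapping.keys (?f y) \<subseteq> M \<times> N"
      using f(1) by (intro order_trans[OF keys_frag_extend]) (auto simp: keys_frag_of)
    then show ?thesis by simp
  qed
  have "K #>\<^bsub>F\<^esub> ?f y = K #>\<^bsub>F\<^esub> ?f x" if y: "y \<in> K #>\<^bsub>F\<^esub> x" for y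
  proof -
    obtain k where k: "k \<in> K" "y = k + x"
      using y by (auto simp: r_coset_def)
    have "y \<in> carrier F"
      using k kernel_keys[OF k(1)] assms(4) keys_add[of k x] by auto
    moreover have "?f y - ?f x \<in> K"
      using frag_extend_kernel[OF f k(1)] by (simp add: k(2) frag_extend_add)
    ultimately show ?thesis
      using assms(4) by (intro coset_eq carrier)
  qed
  moreover have "x \<in> K #>\<^bsub>F\<^esub> x"
    by (rule group.rcos_self[OF group_free_Abelian_group assms(4) subgroup_kernel])
  ultimately show ?thesis
    unfolding tensor_map_left_def by blast
qed

end

section \<open>The principal series as a quotient of the algebra, and its submodules\<close>

context BL_hecke_algebra
begin

lemma char_ext_scale_Z: "char_ext \<tau> (scale c (Z \<nu>)) = c * \<tau> \<nu>"
  by (simp add: char_ext_def ZH_def scale_single)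

context
  fixes \<tau> :: "'v \<Rightarrow> 'f"
  assumes \<tau>: "\<tau> \<in> characters"
begin

interpretation tensor_factors BL_space "UNIV :: 'f set" FY prd "\<lambda>p c. char_ext \<tau> p * c"
  by unfold_locales (auto intro: BL_add closed FY_BL)

text \<open>This is \<open>p \<otimes> 1\<close>. Every element of the principal series has this
  form, so questions about submodules can be pulled back to \<open>BL_space\<close>.\<close>

definition gen_map where "gen_map p = K #>\<^bsub>F\<^esub> frag_of (p, 1)"

lemma I_rep_eq: "I_rep \<tau> = T"
  by (simp add: I_rep_def)

lemma character_zero: "\<tau> 0 = 1"
  using \<tau> Y_zero by (force simp: characters_def)

lemma gen_map_carrier: "p \<in> BL_space \<Longrightarrow> gen_map p \<in> carrier (I_rep \<tau>)"
  unfolding gen_map_def I_rep_eq carrier_tensor_product by (intro imageI) simp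

lemma gen_map_add:
  assumes "p \<in> BL_space" "q \<in> BL_space"
  shows "gen_map (p + q) = gen_map p \<otimes>\<^bsub>I_rep \<tau>\<^esub> gen_map q"
proof -
  have "frag_of (p + q, 1) - frag_of (p, 1) - frag_of (q, 1) \<in> rels"
    unfolding tensor_relations_def using assms by blast
  then have "gen_map (p + q) = K #>\<^bsub>F\<^esub> (frag_of (p, 1) \<otimes>\<^bsub>F\<^esub> frag_of (q, 1))"
    unfolding gen_map_def using assms keys_add[of "frag_of (p, 1)" "frag_of (q, 1::'f)"]
    by (intro coset_eq) (auto simp: keys_frag_of BL_add diff_diff_eq intro: kernel_relation)
  then show ?thesis
    using assms hom_mult[OF coset_hom] by (simp add: gen_map_def I_rep_eq)
qed

text \<open>\<open>c\<close> is the value of the character on \<open>scale c (Z 0)\<close>, so it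
  moves across the tensor sign. The product with \<open>Z 0\<close> on the right is kept, since the
  unit law was established on the left only.\<close>

lemma frag_of_coset:
  assumes "p \<in> BL_space"
  shows "K #>\<^bsub>F\<^esub> frag_of (p, c) = gen_map (p \<star> scale c (Z 0))"
proof -
  let ?x = "scale c (Z 0)"
  have x: "?x \<in> FY" by (intro FY_scale FY_Z Y_zero)
  have "frag_of (p \<star> ?x, 1) - frag_of (p, char_ext \<tau> ?x * 1) \<in> rels"
    unfolding tensor_relations_def using assms x by blast
  then have "frag_of (p \<star> ?x, 1) - frag_of (p, c) \<in> K"
    by (intro kernel_relation) (simp add: char_ext_scale_Z character_zero)
  then show ?thesis
    unfolding gen_map_def using assms x FY_BL closed by (intro coset_eq[symmetric]) auto
qed

lemma group_I_rep: "group (I_rep \<tau>)"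
  unfolding I_rep_eq by (rule group_tensor_product)

lemma gen_map_diff:
  assumes "p \<in> BL_space" "q \<in> BL_space"
  shows "gen_map (p - q) = gen_map p \<otimes>\<^bsub>I_rep \<tau>\<^esub> inv\<^bsub>I_rep \<tau>\<^esub> gen_map q"
  using gen_map_add[of "p - q" q] assms
  by (intro group.inv_solve_right[OF group_I_rep, THEN iffD2] gen_map_carrier BL_diff) (simp_all add: BL_diff)

lemma gen_map_surj:
  assumes "u \<in> carrier (I_rep \<tau>)"
  obtains p where "p \<in> BL_space" "u = gen_map p"
proof -
  obtain x where x: "x \<in> carrier F" "u = K #>\<^bsub>F\<^esub> x"
    using assms unfolding I_rep_eq carrier_tensor_product by blast
  have "Poly_Mapping.keys x \<subseteq> BL_space \<times> UNIV" using x by simp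
  then have "x \<in> carrier F \<and> (\<exists>p\<in>BL_space. K #>\<^bsub>F\<^esub> x = gen_map p)"
  proof (induction x rule: frag_induction)
    case zero
    \<comment> \<open>Zero is written as a difference of generators, so that its class can be
      recognised as that of \<open>0 \<otimes> 1\<close>.\<close>
    have "K #>\<^bsub>F\<^esub> 0 = K #>\<^bsub>F\<^esub> (frag_of (0, 1) - frag_of (0, 1))" by simp
    also have "\<dots> = gen_map 0 \<otimes>\<^bsub>I_rep \<tau>\<^esub> inv\<^bsub>I_rep \<tau>\<^esub> gen_map 0"
      unfolding I_rep_eq gen_map_def by (intro coset_diff) (auto simp: BL_zero)
    also have "\<dots> = gen_map (0 - 0)" using BL_zero by (intro gen_map_diff[symmetric])
    finally show ?case using BL_zero by auto
  next
    case (one k)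
    then show ?case
      using frag_of_coset[of "fst k" "snd k"] closed FY_BL FY_scale FY_Z Y_zero
      by (auto simp: mem_Times_iff intro!: bexI[of _ "fst k \<star> scale (snd k) (Z 0)"])
  next
    case (diff a b)
    then obtain p q where pq: "p \<in> BL_space" "q \<in> BL_space" "K #>\<^bsub>F\<^esub> a = gen_map p" "K #>\<^bsub>F\<^esub> b = gen_map q"
      by blast
    have "K #>\<^bsub>F\<^esub> (a - b) = gen_map (p - q)"
      using diff pq coset_diff[of a b] by (simp add: gen_map_diff I_rep_eq)
    moreover have "a - b \<in> carrier F"
      using diff keys_diff[of a b] by auto
    ultimately show ?case using pq BL_diff by blast
  qed
  then show thesis using that x by auto
qed

text \<open>By distributivity and associativity, left multiplication by \<open>h\<close> is an
  endomorphism of the right \<open>FY\<close>-module, hence well defined on classes.\<close>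

lemma I_act_gen_map:
  assumes "h \<in> BL_space" "p \<in> BL_space"
  shows "I_act \<tau> h (gen_map p) = gen_map (h \<star> p)"
  unfolding I_act_def gen_map_def using assms
  by (subst tensor_map_left_coset) (auto simp: closed add_right FY_BL assoc)

text \<open>Moving \<open>Z \<nu>\<close> across the tensor sign in
  \<open>(Z 0 \<star> Z \<nu>) \<otimes> 1\<close> produces the scalar \<open>\<tau> \<nu>\<close>.
  This supplies the condition \<open>N_char\<close>.\<close>

lemma gen_map_Z:
  assumes "\<nu> \<in> Y"
  shows "gen_map (Z \<nu>) = gen_map (scale (\<tau> \<nu>) (Z 0))"
proof -
  have "frag_of (Z 0 \<star> Z \<nu>, 1) - frag_of (Z 0, char_ext \<tau> (Z \<nu>) * 1) \<in> rels"
    unfolding tensor_relations_def using FY_Z[OF assms] BL_Z[OF Y_zero] by blast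
  then have "frag_of (Z \<nu>, 1) - frag_of (Z 0, \<tau> \<nu>) \<in> K"
    using char_ext_scale_Z[of \<tau> 1 \<nu>] assms Y_zero by (intro kernel_relation) (simp add: Z_Z)
  then have "gen_map (Z \<nu>) = K #>\<^bsub>F\<^esub> frag_of (Z 0, \<tau> \<nu>)"
    unfolding gen_map_def using assms BL_Z Y_zero by (intro coset_eq) auto
  also have "\<dots> = gen_map (scale (\<tau> \<nu>) (Z 0))"
    using BL_Z Y_zero frag_of_coset by (simp add: scale_right Z_Z)
  finally show ?thesis .
qed

text \<open>Pull back along \<open>gen_map\<close>: the kernel \<open>N\<close> is a left ideal of
  the required kind, and the preimage \<open>L\<close> of \<open>M\<close> contains \<open>N\<close>
  and is stable under \<open>H_space\<close>, hence under \<open>BL_space\<close>. Surjectivity of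
  \<open>gen_map\<close> carries this back to \<open>M\<close>.\<close>

lemma H_submodule_imp_BL_submodule:
  assumes "is_submodule (I_rep \<tau>) H_space (I_act \<tau>) M"
  shows "is_submodule (I_rep \<tau>) BL_space (I_act \<tau>) M"
proof -
  have sub: "subgroup M (I_rep \<tau>)" using assms by (simp add: is_submodule_def)
  define N where "N = {p \<in> BL_space. gen_map p = \<one>\<^bsub>I_rep \<tau>\<^esub>}"
  define L where "L = {p \<in> BL_space. gen_map p \<in> M}"
  interpret I: group "I_rep \<tau>" by (rule group_I_rep)
  \<comment> \<open>The identity is the class of 0, and the action fixes it; this makes
    \<open>N\<close> a left ideal.\<close>
  have act_one: "I_act \<tau> h \<one>\<^bsub>I_rep \<tau>\<^esub> = \<one>\<^bsub>I_rep \<tau>\<^esub>" if "h \<in> BL_space" for h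
  proof -
    have one: "gen_map 0 = \<one>\<^bsub>I_rep \<tau>\<^esub>"
      using gen_map_diff[OF BL_zero BL_zero] gen_map_carrier[OF BL_zero] by simp
    show ?thesis
      using I_act_gen_map[OF that BL_zero] that by (simp add: one prd_zero)
  qed
  interpret principal_series_kernel I a Y \<alpha> \<alpha>v \<sigma> \<sigma>' prd N \<tau>
  proof
    show "N \<subseteq> BL_space" by (auto simp: N_def)
    show "p + q \<in> N" if "p \<in> N" "q \<in> N" for p q
      using that by (simp add: N_def BL_add gen_map_add)
    show "h \<star> p \<in> N" if "h \<in> BL_space" "p \<in> N" for h p
      using that act_one by (simp add: N_def closed flip: I_act_gen_map)
    show "\<tau> \<nu> \<noteq> 0" if "\<nu> \<in> Y" for \<nu>
      using \<tau> that by (simp add: characters_def)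
    show "Z \<nu> - scale (\<tau> \<nu>) (Z 0) \<in> N" if "\<nu> \<in> Y" for \<nu>
      using that gen_map_carrier BL_scale BL_Z Y_zero
      by (simp add: N_def BL_diff gen_map_diff gen_map_Z)
  qed
  have "I_act \<tau> h u \<in> M" if h: "h \<in> BL_space" and u: "u \<in> M" for h u
  proof -
    obtain p where p: "p \<in> BL_space" "u = gen_map p"
      using gen_map_surj subgroup.mem_carrier[OF sub u] by blast
    have "h \<star> p \<in> L"
    proof (rule H_space_stable_imp_BL_space_stable)
      show "N \<subseteq> L" using subgroup.one_closed[OF sub] by (auto simp: N_def L_def)
      show "p - q \<in> L" if "p \<in> L" "q \<in> L" for p q
        using that sub by (simp add: L_def BL_diff gen_map_diff subgroup.m_closed subgroup.m_inv_closed)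
      show "h \<star> p \<in> L" if "h \<in> H_space" "p \<in> L" for h p
        using that H_space_subset assms
        by (auto simp: L_def closed is_submodule_def simp flip: I_act_gen_map)
    qed (use p h u in \<open>auto simp: L_def\<close>)
    then show ?thesis
      using p h by (simp add: L_def I_act_gen_map)
  qed
  then show ?thesis
    using sub by (simp add: is_submodule_def)
qed

lemma submodule_iff:
  "is_submodule (I_rep \<tau>) H_space (I_act \<tau>) M \<longleftrightarrow> is_submodule (I_rep \<tau>) BL_space (I_act \<tau>) M"
  using H_submodule_imp_BL_submodule H_space_subset by (auto simp: is_submodule_def)

end

end

theorem proposition2p12:
  fixes I :: "'i set"
    and a :: "'i \<Rightarrow> 'i \<Rightarrow> int"
    and Y :: "'v::real_normed_vector set"
    and \<alpha> :: "'i \<Rightarrow> 'v \<Rightarrow> real"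
    and \<alpha>v :: "'i \<Rightarrow> 'v"
    and \<sigma> \<sigma>' :: "'i \<Rightarrow> 'f::field_char_0"
    and prd :: "('v \<times> ('v \<Rightarrow> 'v) \<Rightarrow>\<^sub>0 'f) \<Rightarrow> ('v \<times> ('v \<Rightarrow> 'v) \<Rightarrow>\<^sub>0 'f) \<Rightarrow> ('v \<times> ('v \<Rightarrow> 'v) \<Rightarrow>\<^sub>0 'f)"
    and \<tau> :: "'v \<Rightarrow> 'f"
  defines "BLH \<equiv> hecke_parameters.BL_space I Y \<alpha> \<alpha>v"
    and "HF \<equiv> hecke_parameters.H_space I Y \<alpha> \<alpha>v"
    and "I\<tau> \<equiv> BL_hecke_algebra.I_rep I Y \<alpha> \<alpha>v prd \<tau>"
    and "act \<equiv> BL_hecke_algebra.I_act I Y \<alpha> \<alpha>v prd \<tau>"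
  assumes "BL_hecke_algebra I a Y \<alpha> \<alpha>v \<sigma> \<sigma>' prd"
    and "\<tau> \<in> hecke_parameters.characters Y"
  shows "(\<forall>M. M \<subseteq> carrier I\<tau> \<longrightarrow> (is_submodule I\<tau> HF act M \<longleftrightarrow> is_submodule I\<tau> BLH act M)) \<and>
         (is_irreducible I\<tau> BLH act \<longleftrightarrow> is_irreducible I\<tau> HF act)"
proof -
  interpret BL_hecke_algebra I a Y \<alpha> \<alpha>v \<sigma> \<sigma>' prd by fact
  have "is_submodule I\<tau> HF act M \<longleftrightarrow> is_submodule I\<tau> BLH act M" for M
    using submodule_iff[OF assms(6)] by (simp add: BLH_def HF_def I\<tau>_def act_def)
  \<comment> \<open>Irreducibility quantifies over submodules, which are the same for both
    algebras.\<close>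
  then show ?thesis
    by (simp add: is_irreducible_def)
qed

end
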